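(* Let $X$ be a metric space and $X=\bigcup_{i\in I}X_i$, where each $X_i$ is a Borel subset of $X$. Suppose that $\{X_i\}_{i\in I}$ has uniform operator norm localization property with constant $0<c\le1$ and that, for each $r>0$, there exists a Borel subset $Y_r\subseteq X$ having the operator norm localization property with constant $c$ such that $\{X_i\setminus Y_r\}_{i\in I}$ is $r$-disjoint. Then $X$ has the operator norm localization property with constant $c-\epsilon$ for every $0<\epsilon<c$.
   Context: Subsets carry the induced metric. A family of subsets $\{Z_i\}_{i\in I}$ is $r$-disjoint if $d(Z_i,Z_j)\ge r$ for all $i\ne j$, where $d(A,B)=\inf\{d(a,b):a\in A,b\in B\}$. Operator norm localization: let $H$ be a separable infinite-dimensional Hilbert space. A Borel measure on a metric space is locally finite if bounded Borel sets have finite measure; positive measures are understood to be nonzero. For a positive locally finite Borel measure $\nu$ on a metric space $Y$, a bounded operator $T$ on $L^2(Y,\nu)\otimes H$ has propagation at most $r$ if $\langle T\varphi,\psi\rangle=0$ whenever $d(\mathrm{Supp}(\varphi),\mathrm{Supp}(\psi))>r$; $\mathcal{A}_r(Y,\nu)$ is the set of such operators. For a non-decreasing $f:\mathbf{N}\to\mathbf{N}$ and $0<c\le 1$, $Y$ has the operator norm localization property with constant $c$ and function $f$ if for every positive locally finite Borel measure $\nu$ on $Y$, every $k\in\mathbf{N}$ and every $T\in\mathcal{A}_k(Y,\nu)$ there is a nonzero $\varphi\in L^2(Y,\nu)\otimes H$ with $\mathrm{Diam}(\mathrm{Supp}(\varphi))\le f(k)$ and $\|T\varphi\|\ge c\|T\|\|\varphi\|$.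 $Y$ has the property with constant $c$ if it does so for some $f$. A family $\{X_i\}_{i\in I}$ has uniform operator norm localization property with constant $c$ if there is a single $f$ such that every $X_i$ has the property with constant $c$ and function $f$. *)

theory Defs
  imports "HOL-Analysis.Analysis"
begin

text \<open>Complex Hilbert spaces, with inner product linear in the first argument. Completeness comes
  from \<^class>\<open>banach\<close>; the last axiom makes the inner product positive definite and ties it to the norm.\<close>

class complex_hilbert = banach +
  fixes scaleC :: "complex \<Rightarrow> 'a \<Rightarrow> 'a"  (infixr "*\<^sub>C" 75)
    and cinner :: "'a \<Rightarrow> 'a \<Rightarrow> complex"
  assumes scaleC_add_right: "a *\<^sub>C (x + y) = a *\<^sub>C x + a *\<^sub>C y"
    and scaleC_add_left: "(a + b) *\<^sub>C x = a *\<^sub>C x + b *\<^sub>C x"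
    and scaleC_scaleC: "a *\<^sub>C (b *\<^sub>C x) = (a * b) *\<^sub>C x"
    and scaleC_of_real: "complex_of_real r *\<^sub>C x = r *\<^sub>R x"
    and cinner_commute: "cinner x y = cnj (cinner y x)"
    and cinner_add_left: "cinner (x + y) z = cinner x z + cinner y z"
    and cinner_scaleC_left: "cinner (a *\<^sub>C x) y = a * cinner x y"
    and cinner_self: "cinner x x = complex_of_real ((norm x)\<^sup>2)"

definition infinite_dimensional :: "'h::complex_hilbert itself \<Rightarrow> bool" where
  "infinite_dimensional _ \<longleftrightarrow>
     \<not> (\<exists>B :: 'h set. finite B \<and> (\<forall>x. \<exists>u. x = (\<Sum>b\<in>B. u b *\<^sub>C b)))"

text \<open>The library's \<^const>\<open>setdist\<close> is 0 when one of the sets is empty; here the infimum over the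
  empty set has to be infinite.\<close>

definition set_distance :: "'a::metric_space set \<Rightarrow> 'a set \<Rightarrow> ereal" where
  "set_distance A B = (INF (a, b) \<in> A \<times> B. ereal (dist a b))"

definition r_disjoint :: "real \<Rightarrow> 'i set \<Rightarrow> ('i \<Rightarrow> 'a::metric_space set) \<Rightarrow> bool" where
  "r_disjoint r I Z \<longleftrightarrow> (\<forall>i\<in>I. \<forall>j\<in>I. i \<noteq> j \<longrightarrow> ereal r \<le> set_distance (Z i) (Z j))"

definition positive_locally_finite_borel :: "'a::metric_space set \<Rightarrow> 'a measure \<Rightarrow> bool" where
  "positive_locally_finite_borel Y \<nu> \<longleftrightarrow>
     sets \<nu> = sets (restrict_space borel Y) \<and>
     emeasure \<nu> (space \<nu>) \<noteq> 0 \<and>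
     (\<forall>B\<in>sets \<nu>. bounded B \<longrightarrow> emeasure \<nu> B < \<infinity>)"

text \<open>The Hilbert space tensor product of \<open>L\<^sup>2(Y,\<nu>)\<close> with a separable \<open>H\<close> is the space of square
  integrable \<open>H\<close>-valued functions on \<open>Y\<close>, the elementary tensor of \<open>f\<close> and \<open>h\<close> being
  \<open>y \<mapsto> f y *\<^sub>C h\<close>. Its elements are represented by functions; equality in it is equality
  \<open>\<nu>\<close>-almost everywhere, and values outside \<open>space \<nu>\<close> are irrelevant.\<close>

definition L2 :: "'a measure \<Rightarrow> ('a \<Rightarrow> 'h::{complex_hilbert,second_countable_topology}) set" where
  "L2 \<nu> = {\<phi>. \<phi> \<in> borel_measurable \<nu> \<and> integrable \<nu> (\<lambda>x. (norm (\<phi> x))\<^sup>2)}"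

definition L2_inner ::
    "'a measure \<Rightarrow> ('a \<Rightarrow> 'h::{complex_hilbert,second_countable_topology}) \<Rightarrow> ('a \<Rightarrow> 'h) \<Rightarrow> complex" where
  "L2_inner \<nu> \<phi> \<psi> = (\<integral>x. cinner (\<phi> x) (\<psi> x) \<partial>\<nu>)"

definition L2_norm :: "'a measure \<Rightarrow> ('a \<Rightarrow> 'h::{complex_hilbert,second_countable_topology}) \<Rightarrow> real" where
  "L2_norm \<nu> \<phi> = sqrt (\<integral>x. (norm (\<phi> x))\<^sup>2 \<partial>\<nu>)"

lemma L2_inner_elementary_tensors:
  fixes h h' :: "'h::{complex_hilbert,second_countable_topology}"
  shows "L2_inner \<nu> (\<lambda>y. f y *\<^sub>C h) (\<lambda>y. g y *\<^sub>C h') = (\<integral>y. f y * cnj (g y) \<partial>\<nu>) * cinner h h'"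
proof -
  have "cinner (a *\<^sub>C h) (b *\<^sub>C h') = a * cnj b * cinner h h'" for a b
    by (subst cinner_scaleC_left, subst cinner_commute, subst cinner_scaleC_left)
      (simp add: cinner_commute[of h h'])
  then show ?thesis
    by (simp add: L2_inner_def)
qed

text \<open>The support is the complement in \<open>Y\<close> of the union of all open sets on which \<open>\<phi>\<close> vanishes
  almost everywhere.\<close>

definition Supp ::
    "'a::metric_space measure \<Rightarrow> ('a \<Rightarrow> 'h::{complex_hilbert,second_countable_topology}) \<Rightarrow> 'a set" where
  "Supp \<nu> \<phi> = space \<nu> - \<Union>{U. open U \<and> (AE x in \<nu>. x \<in> U \<longrightarrow> \<phi> x = 0)}"

definition bounded_operator ::
    "'a measure \<Rightarrow> (('a \<Rightarrow> 'h::{complex_hilbert,second_countable_topology}) \<Rightarrow> ('a \<Rightarrow> 'h)) \<Rightarrow> bool" where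
  "bounded_operator \<nu> T \<longleftrightarrow>
     (\<forall>\<phi>\<in>L2 \<nu>. T \<phi> \<in> L2 \<nu>) \<and>
     (\<forall>\<phi>\<in>L2 \<nu>. \<forall>\<psi>\<in>L2 \<nu>. (AE x in \<nu>. \<phi> x = \<psi> x) \<longrightarrow> (AE x in \<nu>. T \<phi> x = T \<psi> x)) \<and>
     (\<forall>\<phi>\<in>L2 \<nu>. \<forall>\<psi>\<in>L2 \<nu>. AE x in \<nu>. T (\<lambda>y. \<phi> y + \<psi> y) x = T \<phi> x + T \<psi> x) \<and>
     (\<forall>a. \<forall>\<phi>\<in>L2 \<nu>. AE x in \<nu>. T (\<lambda>y. a *\<^sub>C \<phi> y) x = a *\<^sub>C T \<phi> x) \<and>
     (\<exists>C. \<forall>\<phi>\<in>L2 \<nu>. L2_norm \<nu> (T \<phi>) \<le> C * L2_norm \<nu> \<phi>)"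

text \<open>As for the library's \<^const>\<open>onorm\<close>, null vectors contribute the quotient \<open>0 / 0 = 0\<close>.\<close>

definition operator_norm ::
    "'a measure \<Rightarrow> (('a \<Rightarrow> 'h::{complex_hilbert,second_countable_topology}) \<Rightarrow> ('a \<Rightarrow> 'h)) \<Rightarrow> real" where
  "operator_norm \<nu> T = (SUP \<phi>\<in>L2 \<nu>. L2_norm \<nu> (T \<phi>) / L2_norm \<nu> \<phi>)"

definition propagation_at_most ::
    "real \<Rightarrow> 'a::metric_space measure \<Rightarrow>
      (('a \<Rightarrow> 'h::{complex_hilbert,second_countable_topology}) \<Rightarrow> ('a \<Rightarrow> 'h)) set" where
  "propagation_at_most r \<nu> = {T. bounded_operator \<nu> T \<and>
     (\<forall>\<phi>\<in>L2 \<nu>. \<forall>\<psi>\<in>L2 \<nu>.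
        set_distance (Supp \<nu> \<phi>) (Supp \<nu> \<psi>) > ereal r \<longrightarrow> L2_inner \<nu> (T \<phi>) \<psi> = 0)}"

text \<open>The explicit \<^const>\<open>bounded\<close> is needed because \<^const>\<open>diameter\<close> is meaningless on unbounded sets.\<close>

definition onl_with ::
    "'h::{complex_hilbert,second_countable_topology} itself \<Rightarrow>
      'a::metric_space set \<Rightarrow> real \<Rightarrow> (nat \<Rightarrow> nat) \<Rightarrow> bool" where
  "onl_with _ Y c f \<longleftrightarrow>
     (\<forall>\<nu>. positive_locally_finite_borel Y \<nu> \<longrightarrow>
       (\<forall>k::nat. \<forall>T \<in> propagation_at_most (real k) \<nu>.
         \<exists>\<phi> :: 'a \<Rightarrow> 'h. \<phi> \<in> L2 \<nu> \<and> \<not> (AE x in \<nu>. \<phi> x = 0) \<and>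
           bounded (Supp \<nu> \<phi>) \<and> diameter (Supp \<nu> \<phi>) \<le> real (f k) \<and>
           L2_norm \<nu> (T \<phi>) \<ge> c * operator_norm \<nu> T * L2_norm \<nu> \<phi>))"

definition operator_norm_localization ::
    "'h::{complex_hilbert,second_countable_topology} itself \<Rightarrow> 'a::metric_space set \<Rightarrow> real \<Rightarrow> bool" where
  "operator_norm_localization H Y c \<longleftrightarrow> (\<exists>f. mono f \<and> onl_with H Y c f)"

definition uniform_operator_norm_localization ::
    "'h::{complex_hilbert,second_countable_topology} itself \<Rightarrow>
      'i set \<Rightarrow> ('i \<Rightarrow> 'a::metric_space set) \<Rightarrow> real \<Rightarrow> bool" where
  "uniform_operator_norm_localization H I X c \<longleftrightarrow>
     (\<exists>f. mono f \<and> (\<forall>i\<in>I. onl_with H (X i) c f))"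

end

theory Submission
  imports Defs
begin

text \<open>Take \<open>\<phi>\<close> almost attaining \<open>\<parallel>T\<parallel>\<close> and \<open>Y = Y\<^sub>r\<close> with \<open>r\<close> large compared to the propagation
  \<open>k\<close>. By the pigeonhole principle one of many consecutive shells around \<open>Y\<close> carries little of \<open>\<phi>\<close>;
  deleting it splits \<open>\<phi>\<close> into a part near \<open>Y\<close> and a part away from \<open>Y\<close>, and the latter splits further
  into parts on the sets \<open>A i\<close>. All these parts are so far apart that their images under \<open>T\<close> are
  orthogonal, so \<open>T\<close> is almost norm attaining on one of them. That part lives near a set \<open>Z\<close>
  (\<open>Y\<close> or some \<open>A i\<close>) with the localization property. Cutting it and its image into finitely many
  pieces attached to points of \<open>Z\<close> turns \<open>T\<close> into a finite matrix over a counting measure on \<open>Z\<close>, to which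
  the property of \<open>Z\<close> applies.\<close>

section \<open>Complex Hilbert spaces\<close>

text \<open>The obstacle is that the property of Z (\<open>Y\<close> or some \<open>A i\<close>)
  speaks only of measures on Z itself. The measure \<nu> may give Z measure zero, and T moves
  functions off Z, so T cannot simply be restricted to Z. The discrete model avoids this: mass near
  Z is booked at nearby points of Z, at the price of enlarging the propagation and the diameter by a
  fixed amount. The model needs finitely many points, so both \<phi> and its image must first be
  reduced to finitely many balls, although the space need not be separable. Two functions at
  distance 2k+3 have almost everywhere disjoint images: k for each of them, and a margin for infima
  that are not attained. Hence the shells have width 2k+3, and \<open>r\<close> is taken to be 2k+3.
  With more than 4/\<epsilon>^2 shells the deleted part has norm at most \<epsilon>/2 times that of
  \<phi>; the other \<epsilon>/2 pays for the choice of \<phi>. Some part then attains the fraction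
  1-\<epsilon> of the norm of T, the discrete model costs the factor c, and c(1-\<epsilon>) is at
  least c-\<epsilon> because c is at most 1.\<close>

lemma cinner_add_right: "cinner x (y + z) = cinner x y + cinner x (z::'h::complex_hilbert)"
  using cinner_commute[of x "y + z"] cinner_commute[of x y] cinner_commute[of x z]
  by (simp add: cinner_add_left)

lemma cinner_scaleC_right: "cinner x (a *\<^sub>C y) = cnj a * cinner x (y::'h::complex_hilbert)"
  using cinner_commute[of x "a *\<^sub>C y"] cinner_commute[of x y]
  by (simp add: cinner_scaleC_left)

lemma cinner_scaleR_left: "cinner (r *\<^sub>R x) y = complex_of_real r * cinner x (y::'h::complex_hilbert)"
  by (metis cinner_scaleC_left scaleC_of_real)

lemma cinner_scaleR_right: "cinner x (r *\<^sub>R y) = complex_of_real r * cinner x (y::'h::complex_hilbert)"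
  by (metis cinner_scaleC_right scaleC_of_real complex_cnj_complex_of_real)

lemma norm_scaleC: "norm (a *\<^sub>C x) = cmod a * norm (x::'h::complex_hilbert)"
proof -
  have "complex_of_real ((norm (a *\<^sub>C x))\<^sup>2) = a * cnj a * complex_of_real ((norm x)\<^sup>2)"
    by (simp only: cinner_self[symmetric] cinner_scaleC_left cinner_scaleC_right ac_simps)
  also have "\<dots> = complex_of_real ((cmod a * norm x)\<^sup>2)"
    by (simp only: complex_norm_square[symmetric] power_mult_distrib of_real_mult of_real_power)
  finally have "(norm (a *\<^sub>C x))\<^sup>2 = (cmod a * norm x)\<^sup>2"
    using of_real_eq_iff by blast
  then show ?thesis
    by (rule power2_eq_imp_eq) auto
qed

lemma bounded_linear_scaleC: "bounded_linear (\<lambda>x::'h::complex_hilbert. a *\<^sub>C x)"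
proof (rule bounded_linear_intro[where K = "cmod a"])
  show "a *\<^sub>C (r *\<^sub>R x) = r *\<^sub>R (a *\<^sub>C x)" for r and x :: 'h
    by (metis mult.commute scaleC_of_real scaleC_scaleC)
qed (auto simp: scaleC_add_right norm_scaleC mult.commute)

lemmas scaleC_zero_right = linear_0[OF bounded_linear.linear[OF bounded_linear_scaleC]]

lemma scaleC_zero_left [simp]: "0 *\<^sub>C x = (0::'h::complex_hilbert)"
  using scaleC_of_real[of 0 x] by simp

lemma Re_cinner_le: "Re (cinner x y) \<le> norm x * norm (y::'h::complex_hilbert)"
proof (cases "norm x * norm y = 0")
  case True
  have "cinner x y = 0"
    using True cinner_scaleR_left[of 0 x y] cinner_scaleR_right[of x 0 y] by auto
  then show ?thesis by simp
next
  case False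
  have sq: "(norm (u + v))\<^sup>2 = (norm u)\<^sup>2 + (norm v)\<^sup>2 + 2 * Re (cinner u v)" for u v :: 'h
  proof -
    have "complex_of_real ((norm (u + v))\<^sup>2)
        = complex_of_real ((norm u)\<^sup>2) + complex_of_real ((norm v)\<^sup>2) + (cinner u v + cnj (cinner u v))"
      by (simp only: cinner_self[symmetric] cinner_add_left cinner_add_right
          cinner_commute[of v u] ac_simps)
    then have "Re (complex_of_real ((norm (u + v))\<^sup>2))
        = Re (complex_of_real ((norm u)\<^sup>2) + complex_of_real ((norm v)\<^sup>2) + (cinner u v + cnj (cinner u v)))"
      by (rule arg_cong)
    then show ?thesis by simp
  qed
  have "0 \<le> (norm (norm y *\<^sub>R x + (- norm x) *\<^sub>R y))\<^sup>2" by simp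
  also have "\<dots> = 2 * (norm x * norm y) * (norm x * norm y - Re (cinner x y))"
    unfolding sq
    by (simp add: cinner_scaleR_left cinner_scaleR_right power2_eq_square algebra_simps del: scaleR_minus_left)
  finally show ?thesis
    using False by (auto simp: zero_le_mult_iff mult_le_0_iff)
qed

lemma cmod_cinner_le: "cmod (cinner x y) \<le> norm x * norm (y::'h::complex_hilbert)"
proof (cases "cinner x y = 0")
  case False
  \<comment> \<open>A phase that turns the inner product into its modulus, so that the bound on real
    parts suffices.\<close>
  define a where "a = cnj (cinner x y) / cmod (cinner x y)"
  have "cmod a = 1"
    using False by (simp add: a_def norm_divide)
  have "cinner (a *\<^sub>C x) y = complex_of_real (cmod (cinner x y))"
    using False complex_norm_square[of "cinner x y"]
    by (simp add: a_def cinner_scaleC_left field_simps power2_eq_square)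
  then have "cmod (cinner x y) = Re (cinner (a *\<^sub>C x) y)" by simp
  also have "\<dots> \<le> norm x * norm y"
    using Re_cinner_le[of "a *\<^sub>C x" y] by (simp add: norm_scaleC \<open>cmod a = 1\<close>)
  finally show ?thesis .
qed simp

lemma bounded_bilinear_cinner: "bounded_bilinear (cinner :: 'h::complex_hilbert \<Rightarrow> 'h \<Rightarrow> complex)"
proof
  show "\<exists>K. \<forall>a b::'h. norm (cinner a b) \<le> norm a * norm b * K"
    by (rule exI[of _ 1]) (simp add: cmod_cinner_le)
qed (auto simp: cinner_add_left cinner_add_right cinner_scaleR_left cinner_scaleR_right scaleR_conv_of_real)

interpretation cinner: bounded_bilinear "cinner :: 'h::complex_hilbert \<Rightarrow> 'h \<Rightarrow> complex"
  by (rule bounded_bilinear_cinner)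

lemma borel_measurable_cinner [measurable (raw)]:
  fixes f g :: "'a \<Rightarrow> 'h::{complex_hilbert,second_countable_topology}"
  assumes "f \<in> borel_measurable M" "g \<in> borel_measurable M"
  shows "(\<lambda>x. cinner (f x) (g x)) \<in> borel_measurable M"
  by (rule borel_measurable_continuous_Pair[OF assms])
    (intro cinner.continuous_on continuous_on_fst continuous_on_snd continuous_on_id)

lemma borel_measurable_scaleC_const [measurable (raw)]:
  fixes f :: "'a \<Rightarrow> 'h::{complex_hilbert,second_countable_topology}"
  assumes "f \<in> borel_measurable M"
  shows "(\<lambda>x. a *\<^sub>C f x) \<in> borel_measurable M"
  by (rule borel_measurable_continuous_on[OF _ assms])
    (intro linear_continuous_on bounded_linear_scaleC)

section \<open>Square integrable functions\<close>

lemma L2_iff: "\<phi> \<in> L2 \<nu> \<longleftrightarrow> \<phi> \<in> borel_measurable \<nu> \<and> integrable \<nu> (\<lambda>x. (norm (\<phi> x))\<^sup>2)"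
  by (simp add: L2_def)

lemma L2_measurable [measurable_dest]: "\<phi> \<in> L2 \<nu> \<Longrightarrow> \<phi> \<in> borel_measurable \<nu>"
  by (simp add: L2_def)

lemma L2_integrable: "\<phi> \<in> L2 \<nu> \<Longrightarrow> integrable \<nu> (\<lambda>x. (norm (\<phi> x))\<^sup>2)"
  by (simp add: L2_def)

lemma L2_norm_nonneg [simp]: "0 \<le> L2_norm \<nu> \<phi>"
  by (simp add: L2_norm_def)

lemma L2_norm_power2: "(L2_norm \<nu> \<phi>)\<^sup>2 = (\<integral>x. (norm (\<phi> x))\<^sup>2 \<partial>\<nu>)"
  by (simp add: L2_norm_def)

lemma L2_bound:
  assumes "\<phi> \<in> L2 \<nu>" and [measurable]: "\<psi> \<in> borel_measurable \<nu>"
    and "\<And>x. norm (\<psi> x) \<le> C * norm (\<phi> x)"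
  shows "\<psi> \<in> L2 \<nu>"
proof -
  have "integrable \<nu> (\<lambda>x. C\<^sup>2 * (norm (\<phi> x))\<^sup>2)"
    using L2_integrable[OF assms(1)] by simp
  then have "integrable \<nu> (\<lambda>x. (norm (\<psi> x))\<^sup>2)"
  proof (rule Bochner_Integration.integrable_bound)
    have "(norm (\<psi> x))\<^sup>2 \<le> C\<^sup>2 * (norm (\<phi> x))\<^sup>2" for x
      using power_mono[OF assms(3)[of x], of 2] by (simp add: power_mult_distrib)
    then show "AE x in \<nu>. norm ((norm (\<psi> x))\<^sup>2) \<le> norm (C\<^sup>2 * (norm (\<phi> x))\<^sup>2)"
      by simp
  qed simp
  then show ?thesis by (simp add: L2_iff)
qed

lemma L2_zero [simp]: "(\<lambda>x. 0) \<in> L2 \<nu>"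
  by (simp add: L2_def)

lemma L2_add [intro]:
  assumes "\<phi> \<in> L2 \<nu>" "\<psi> \<in> L2 \<nu>"
  shows "(\<lambda>x. \<phi> x + \<psi> x) \<in> L2 \<nu>"
proof -
  have [measurable]: "\<phi> \<in> borel_measurable \<nu>" "\<psi> \<in> borel_measurable \<nu>"
    using assms by (simp_all add: L2_def)
  have "integrable \<nu> (\<lambda>x. 2 * (norm (\<phi> x))\<^sup>2 + 2 * (norm (\<psi> x))\<^sup>2)"
    using assms by (simp add: L2_integrable)
  then have "integrable \<nu> (\<lambda>x. (norm (\<phi> x + \<psi> x))\<^sup>2)"
  proof (rule Bochner_Integration.integrable_bound)
    have "(norm (\<phi> x + \<psi> x))\<^sup>2 \<le> 2 * (norm (\<phi> x))\<^sup>2 + 2 * (norm (\<psi> x))\<^sup>2" for x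
    proof -
      have "(norm (\<phi> x + \<psi> x))\<^sup>2 \<le> (norm (\<phi> x) + norm (\<psi> x))\<^sup>2"
        by (intro power_mono norm_triangle_ineq) auto
      also have "\<dots> \<le> 2 * (norm (\<phi> x))\<^sup>2 + 2 * (norm (\<psi> x))\<^sup>2"
        using zero_le_power2[of "norm (\<phi> x) - norm (\<psi> x)"] by (simp add: power2_eq_square algebra_simps)
      finally show ?thesis .
    qed
    then show "AE x in \<nu>. norm ((norm (\<phi> x + \<psi> x))\<^sup>2)
        \<le> norm (2 * (norm (\<phi> x))\<^sup>2 + 2 * (norm (\<psi> x))\<^sup>2)"
      by simp
  qed simp
  then show ?thesis by (simp add: L2_iff)
qed

lemma L2_scaleC [intro]: "\<phi> \<in> L2 \<nu> \<Longrightarrow> (\<lambda>x. a *\<^sub>C \<phi> x) \<in> L2 \<nu>"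
  by (rule L2_bound[where C = "cmod a"]) (auto simp: norm_scaleC dest: L2_measurable)

lemma L2_sum: "(\<And>i. i \<in> D \<Longrightarrow> \<phi> i \<in> L2 \<nu>) \<Longrightarrow> (\<lambda>x. \<Sum>i\<in>D. \<phi> i x) \<in> L2 \<nu>"
  by (induction D rule: infinite_finite_induct) (auto intro!: L2_add)

lemma L2_norm_cong_AE:
  assumes "\<phi> \<in> borel_measurable \<nu>" "\<psi> \<in> borel_measurable \<nu>" "AE x in \<nu>. \<phi> x = \<psi> x"
  shows "L2_norm \<nu> \<phi> = L2_norm \<nu> \<psi>"
proof -
  have "(\<integral>x. (norm (\<phi> x))\<^sup>2 \<partial>\<nu>) = (\<integral>x. (norm (\<psi> x))\<^sup>2 \<partial>\<nu>)"
    using assms by (intro integral_cong_AE) auto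
  then show ?thesis by (simp add: L2_norm_def)
qed

lemma L2_norm_eq_0_iff:
  assumes "\<phi> \<in> L2 \<nu>"
  shows "L2_norm \<nu> \<phi> = 0 \<longleftrightarrow> (AE x in \<nu>. \<phi> x = 0)"
  using integral_nonneg_eq_0_iff_AE[OF L2_integrable[OF assms]] by (simp add: L2_norm_def)

lemma L2_norm_scaleC: "L2_norm \<nu> (\<lambda>x. a *\<^sub>C \<phi> x) = cmod a * L2_norm \<nu> \<phi>"
  by (simp add: L2_norm_def norm_scaleC power_mult_distrib real_sqrt_mult)

lemma integrable_norm_mult:
  assumes "\<phi> \<in> L2 \<nu>" "\<psi> \<in> L2 \<nu>"
  shows "integrable \<nu> (\<lambda>x. norm (\<phi> x) * norm (\<psi> x))"
proof -
  have [measurable]: "\<phi> \<in> borel_measurable \<nu>" "\<psi> \<in> borel_measurable \<nu>"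
    using assms by (simp_all add: L2_def)
  have "integrable \<nu> (\<lambda>x. (norm (\<phi> x))\<^sup>2 + (norm (\<psi> x))\<^sup>2)"
    using assms by (simp add: L2_integrable)
  then show ?thesis
  proof (rule Bochner_Integration.integrable_bound)
    have "norm (\<phi> x) * norm (\<psi> x) \<le> (norm (\<phi> x))\<^sup>2 + (norm (\<psi> x))\<^sup>2" for x
      using sum_squares_bound[of "norm (\<phi> x)" "norm (\<psi> x)"]
        mult_nonneg_nonneg[OF norm_ge_zero[of "\<phi> x"] norm_ge_zero[of "\<psi> x"]]
      unfolding mult.assoc by linarith
    then show "AE x in \<nu>. norm (norm (\<phi> x) * norm (\<psi> x)) \<le> norm ((norm (\<phi> x))\<^sup>2 + (norm (\<psi> x))\<^sup>2)"
      by simp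
  qed simp
qed

text \<open>Cauchy-Schwarz from a weighted inequality of arithmetic and geometric means. The weights
  b/(2a) and a/(2b) make each of the two terms integrate to half of ab.\<close>

lemma integral_norm_mult_le:
  assumes "\<phi> \<in> L2 \<nu>" "\<psi> \<in> L2 \<nu>"
  shows "(\<integral>x. norm (\<phi> x) * norm (\<psi> x) \<partial>\<nu>) \<le> L2_norm \<nu> \<phi> * L2_norm \<nu> \<psi>"
proof (cases "L2_norm \<nu> \<phi> = 0 \<or> L2_norm \<nu> \<psi> = 0")
  case True
  then have "AE x in \<nu>. norm (\<phi> x) * norm (\<psi> x) = 0"
    using assms L2_norm_eq_0_iff[OF assms(1)] L2_norm_eq_0_iff[OF assms(2)] by auto
  then have "(\<integral>x. norm (\<phi> x) * norm (\<psi> x) \<partial>\<nu>) = 0"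
    by (rule integral_eq_zero_AE)
  then show ?thesis by simp
next
  case False
  define a b where "a = L2_norm \<nu> \<phi>" and "b = L2_norm \<nu> \<psi>"
  have pos: "a > 0" "b > 0"
    using False by (auto simp: a_def b_def less_le)
  have "(\<integral>x. norm (\<phi> x) * norm (\<psi> x) \<partial>\<nu>)
      \<le> (\<integral>x. (b / (2 * a)) * (norm (\<phi> x))\<^sup>2 + (a / (2 * b)) * (norm (\<psi> x))\<^sup>2 \<partial>\<nu>)"
  proof (rule integral_mono)
    show "norm (\<phi> x) * norm (\<psi> x) \<le> (b / (2 * a)) * (norm (\<phi> x))\<^sup>2 + (a / (2 * b)) * (norm (\<psi> x))\<^sup>2" for x
      using pos zero_le_power2[of "b * norm (\<phi> x) - a * norm (\<psi> x)"]
      by (simp add: field_simps power2_eq_square)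
  qed (use assms in \<open>auto simp: integrable_norm_mult L2_integrable\<close>)
  also have "\<dots> = (b / (2 * a)) * a\<^sup>2 + (a / (2 * b)) * b\<^sup>2"
    using assms by (simp add: L2_integrable L2_norm_power2[symmetric] a_def b_def)
  also have "\<dots> = a * b"
    using pos by (simp add: field_simps power2_eq_square)
  finally show ?thesis by (simp add: a_def b_def)
qed

lemma L2_norm_triangle:
  assumes "\<phi> \<in> L2 \<nu>" "\<psi> \<in> L2 \<nu>"
  shows "L2_norm \<nu> (\<lambda>x. \<phi> x + \<psi> x) \<le> L2_norm \<nu> \<phi> + L2_norm \<nu> \<psi>"
proof (rule power2_le_imp_le)
  have "(L2_norm \<nu> (\<lambda>x. \<phi> x + \<psi> x))\<^sup>2
      \<le> (\<integral>x. (norm (\<phi> x))\<^sup>2 + (norm (\<psi> x))\<^sup>2 + 2 * (norm (\<phi> x) * norm (\<psi> x)) \<partial>\<nu>)"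
    unfolding L2_norm_power2
  proof (rule integral_mono)
    show "(norm (\<phi> x + \<psi> x))\<^sup>2 \<le> (norm (\<phi> x))\<^sup>2 + (norm (\<psi> x))\<^sup>2 + 2 * (norm (\<phi> x) * norm (\<psi> x))" for x
      using power_mono[OF norm_triangle_ineq[of "\<phi> x" "\<psi> x"], of 2]
      by (simp add: power2_eq_square algebra_simps)
  qed (use assms in \<open>auto simp: integrable_norm_mult L2_integrable L2_add\<close>)
  also have "\<dots> = (L2_norm \<nu> \<phi>)\<^sup>2 + (L2_norm \<nu> \<psi>)\<^sup>2 + 2 * (\<integral>x. norm (\<phi> x) * norm (\<psi> x) \<partial>\<nu>)"
    using assms by (simp add: L2_norm_power2 integrable_norm_mult L2_integrable)
  also have "\<dots> \<le> (L2_norm \<nu> \<phi> + L2_norm \<nu> \<psi>)\<^sup>2"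
    using integral_norm_mult_le[OF assms] by (simp add: power2_sum)
  finally show "(L2_norm \<nu> (\<lambda>x. \<phi> x + \<psi> x))\<^sup>2 \<le> (L2_norm \<nu> \<phi> + L2_norm \<nu> \<psi>)\<^sup>2" .
qed simp

lemma integrable_cinner:
  assumes "\<phi> \<in> L2 \<nu>" "\<psi> \<in> L2 \<nu>"
  shows "integrable \<nu> (\<lambda>x. cinner (\<phi> x) (\<psi> x))"
proof (rule Bochner_Integration.integrable_bound[OF integrable_norm_mult[OF assms]])
  show "(\<lambda>x. cinner (\<phi> x) (\<psi> x)) \<in> borel_measurable \<nu>"
    using assms by (auto simp: L2_iff)
qed (auto simp: cmod_cinner_le)

lemma cmod_L2_inner_le:
  assumes "\<phi> \<in> L2 \<nu>" "\<psi> \<in> L2 \<nu>"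
  shows "cmod (L2_inner \<nu> \<phi> \<psi>) \<le> L2_norm \<nu> \<phi> * L2_norm \<nu> \<psi>"
proof -
  have "cmod (L2_inner \<nu> \<phi> \<psi>) \<le> (\<integral>x. norm (\<phi> x) * norm (\<psi> x) \<partial>\<nu>)"
    unfolding L2_inner_def
    by (rule order_trans[OF integral_norm_bound integral_mono])
      (use assms in \<open>auto simp: integrable_cinner integrable_norm_mult cmod_cinner_le\<close>)
  also have "\<dots> \<le> L2_norm \<nu> \<phi> * L2_norm \<nu> \<psi>"
    by (rule integral_norm_mult_le[OF assms])
  finally show ?thesis .
qed

lemma L2_inner_add_left:
  assumes "\<phi> \<in> L2 \<nu>" "\<phi>' \<in> L2 \<nu>" "\<psi> \<in> L2 \<nu>"
  shows "L2_inner \<nu> (\<lambda>x. \<phi> x + \<phi>' x) \<psi> = L2_inner \<nu> \<phi> \<psi> + L2_inner \<nu> \<phi>' \<psi>"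
  using assms by (simp add: L2_inner_def cinner_add_left integrable_cinner)

lemma L2_inner_scaleC_left:
  "L2_inner \<nu> (\<lambda>x. a *\<^sub>C \<phi> x) \<psi> = a * L2_inner \<nu> \<phi> \<psi>"
  by (simp add: L2_inner_def cinner_scaleC_left)

lemma L2_inner_cong_AE:
  assumes "\<phi> \<in> L2 \<nu>" "\<phi>' \<in> L2 \<nu>" "\<psi> \<in> L2 \<nu>" "AE x in \<nu>. \<phi> x = \<phi>' x"
  shows "L2_inner \<nu> \<phi> \<psi> = L2_inner \<nu> \<phi>' \<psi>"
  unfolding L2_inner_def using assms
  by (intro integral_cong_AE) (auto simp: L2_iff)

section \<open>Cutoffs by measurable sets and Pythagoras for disjoint pieces\<close>

abbreviation cutoff :: "'a set \<Rightarrow> ('a \<Rightarrow> 'h::real_vector) \<Rightarrow> 'a \<Rightarrow> 'h" where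
  "cutoff B \<phi> \<equiv> \<lambda>x. indicator B x *\<^sub>R \<phi> x"

lemma L2_cutoff [intro]:
  assumes "\<phi> \<in> L2 \<nu>" "B \<in> sets \<nu>"
  shows "cutoff B \<phi> \<in> L2 \<nu>"
proof (rule L2_bound[OF assms(1), where C = 1])
  show "cutoff B \<phi> \<in> borel_measurable \<nu>"
    using assms by (auto simp: L2_iff)
qed (auto simp: indicator_def)

lemma L2_norm_disjoint:
  assumes "\<phi> \<in> L2 \<nu>" "\<psi> \<in> L2 \<nu>" "AE x in \<nu>. \<phi> x = 0 \<or> \<psi> x = 0"
  shows "(L2_norm \<nu> (\<lambda>x. \<phi> x + \<psi> x))\<^sup>2 = (L2_norm \<nu> \<phi>)\<^sup>2 + (L2_norm \<nu> \<psi>)\<^sup>2"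
proof -
  have [measurable]: "\<phi> \<in> borel_measurable \<nu>" "\<psi> \<in> borel_measurable \<nu>"
    using assms by (simp_all add: L2_def)
  have "(L2_norm \<nu> (\<lambda>x. \<phi> x + \<psi> x))\<^sup>2 = (\<integral>x. (norm (\<phi> x))\<^sup>2 + (norm (\<psi> x))\<^sup>2 \<partial>\<nu>)"
    unfolding L2_norm_power2 using assms(3) by (intro integral_cong_AE) auto
  then show ?thesis
    using assms by (simp add: L2_norm_power2 L2_integrable)
qed

lemma L2_norm_mono:
  assumes "\<phi> \<in> L2 \<nu>" "\<psi> \<in> L2 \<nu>" "\<And>x. x \<in> space \<nu> \<Longrightarrow> norm (\<phi> x) \<le> norm (\<psi> x)"
  shows "L2_norm \<nu> \<phi> \<le> L2_norm \<nu> \<psi>"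
  unfolding L2_norm_def using assms
  by (auto intro!: integral_mono simp: L2_integrable)

lemma L2_norm_cutoff_le: "\<phi> \<in> L2 \<nu> \<Longrightarrow> B \<in> sets \<nu> \<Longrightarrow> L2_norm \<nu> (cutoff B \<phi>) \<le> L2_norm \<nu> \<phi>"
  by (rule L2_norm_mono[OF L2_cutoff]) (auto simp: indicator_def)

lemma sum_L2_norm_cutoff:
  assumes "\<phi> \<in> L2 \<nu>" "finite D" "\<And>i. i \<in> D \<Longrightarrow> P i \<in> sets \<nu>" "disjoint_family_on P D"
  shows "(\<Sum>i\<in>D. (L2_norm \<nu> (cutoff (P i) \<phi>))\<^sup>2) = (L2_norm \<nu> (cutoff (\<Union>i\<in>D. P i) \<phi>))\<^sup>2"
  using assms(2,3,4)
proof (induction D)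
  case (insert i D)
  have disj: "P i \<inter> (\<Union>i\<in>D. P i) = {}"
    using insert.hyps insert.prems(2) by (auto simp: disjoint_family_on_def)
  have "(L2_norm \<nu> (\<lambda>x. cutoff (P i) \<phi> x + cutoff (\<Union>i\<in>D. P i) \<phi> x))\<^sup>2
     = (L2_norm \<nu> (cutoff (P i) \<phi>))\<^sup>2 + (L2_norm \<nu> (cutoff (\<Union>i\<in>D. P i) \<phi>))\<^sup>2"
    using insert.prems(1) insert.hyps(1) disj
    by (intro L2_norm_disjoint L2_cutoff assms(1) sets.finite_UN) (auto simp: indicator_def)
  moreover have "(\<lambda>x. cutoff (P i) \<phi> x + cutoff (\<Union>i\<in>D. P i) \<phi> x) = cutoff (\<Union>i\<in>insert i D. P i) \<phi>"
    using disj by (auto simp: indicator_def fun_eq_iff)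
  moreover have "disjoint_family_on P D"
    using insert.prems(2) by (auto simp: disjoint_family_on_def)
  ultimately show ?case
    using insert.hyps insert.IH insert.prems(1) by simp
qed (simp add: L2_norm_def)

section \<open>Supports and operators of finite propagation\<close>

text \<open>The complement of the closure is one of the open sets removed in \<open>Supp\<close>.
  The closure cannot be dropped, but it changes neither distances nor diameters.\<close>

lemma Supp_subset_closure:
  assumes "\<And>x. x \<in> space \<nu> \<Longrightarrow> x \<notin> A \<Longrightarrow> \<phi> x = 0"
  shows "Supp \<nu> \<phi> \<subseteq> closure A"
proof
  fix x assume x: "x \<in> Supp \<nu> \<phi>"
  have "AE y in \<nu>. y \<in> - closure A \<longrightarrow> \<phi> y = 0"
    using assms closure_subset by (intro AE_I2) blast
  then have "- closure A \<in> {U. open U \<and> (AE y in \<nu>. y \<in> U \<longrightarrow> \<phi> y = 0)}"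
    by auto
  then have "x \<notin> - closure A"
    using x unfolding Supp_def by blast
  then show "x \<in> closure A" by simp
qed

text \<open>Points of the closures are approximated within e/2 from A and B. Empty sets are covered
  too, since the infimum is then infinite.\<close>

lemma set_distance_closure_ge:
  fixes A B :: "'a::metric_space set"
  assumes "\<And>a b. a \<in> A \<Longrightarrow> b \<in> B \<Longrightarrow> \<rho> \<le> dist a b"
    and "S \<subseteq> closure A" "S' \<subseteq> closure B"
  shows "ereal \<rho> \<le> set_distance S S'"
  unfolding set_distance_def
proof (rule INF_greatest, clarify)
  fix x y assume "x \<in> S" "y \<in> S'"
  then have xy: "x \<in> closure A" "y \<in> closure B" using assms by auto
  have "\<rho> \<le> dist x y"
  proof (rule field_le_epsilon)
    fix e :: real assume "0 < e"
    then obtain a b where ab: "a \<in> A" "dist a x < e / 2" "b \<in> B" "dist b y < e / 2"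
      using xy unfolding closure_approachable by (meson half_gt_zero)
    have "dist a b \<le> dist a x + (dist x y + dist b y)"
      by (metis add_left_mono dist_commute dist_triangle2 dist_triangle_le order_trans)
    then show "\<rho> \<le> dist x y + e"
      using assms(1)[OF ab(1,3)] ab by linarith
  qed
  then show "ereal \<rho> \<le> ereal (dist x y)" by simp
qed

lemma infdist_lessE:
  fixes x :: "'a::metric_space"
  assumes "A \<noteq> {}" "infdist x A < e"
  obtains a where "a \<in> A" "dist x a < e"
proof -
  have "bdd_below (dist x ` A)" by (rule bdd_belowI[where m = 0]) auto
  then show ?thesis
    using assms that cINF_less_iff[of A "dist x" e] by (auto simp: infdist_notempty)
qed

section \<open>Bounded operators and the operator norm\<close>

lemma bounded_operatorD:
  assumes "bounded_operator \<nu> T"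
  shows bounded_operator_L2: "\<phi> \<in> L2 \<nu> \<Longrightarrow> T \<phi> \<in> L2 \<nu>"
    and bounded_operator_cong: "\<phi> \<in> L2 \<nu> \<Longrightarrow> \<psi> \<in> L2 \<nu> \<Longrightarrow> AE x in \<nu>. \<phi> x = \<psi> x \<Longrightarrow> AE x in \<nu>. T \<phi> x = T \<psi> x"
    and bounded_operator_add: "\<phi> \<in> L2 \<nu> \<Longrightarrow> \<psi> \<in> L2 \<nu> \<Longrightarrow> AE x in \<nu>. T (\<lambda>y. \<phi> y + \<psi> y) x = T \<phi> x + T \<psi> x"
    and bounded_operator_scaleC: "\<phi> \<in> L2 \<nu> \<Longrightarrow> AE x in \<nu>. T (\<lambda>y. a *\<^sub>C \<phi> y) x = a *\<^sub>C T \<phi> x"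
  using assms by (auto simp: bounded_operator_def)

context
  fixes \<nu> :: "'a measure"
    and T :: "('a \<Rightarrow> 'h::{complex_hilbert,second_countable_topology}) \<Rightarrow> ('a \<Rightarrow> 'h)"
  assumes T: "bounded_operator \<nu> T"
begin

lemma bdd_above_operator_norm: "bdd_above ((\<lambda>\<phi>. L2_norm \<nu> (T \<phi>) / L2_norm \<nu> \<phi>) ` L2 \<nu>)"
proof -
  obtain C where C: "\<And>\<phi>. \<phi> \<in> L2 \<nu> \<Longrightarrow> L2_norm \<nu> (T \<phi>) \<le> C * L2_norm \<nu> \<phi>"
    using T unfolding bounded_operator_def by blast
  \<comment> \<open>The maximum with 0 accounts for null vectors, whose quotient is 0 while C could
    be negative.\<close>
  have "L2_norm \<nu> (T \<phi>) / L2_norm \<nu> \<phi> \<le> max C 0" if "\<phi> \<in> L2 \<nu>" for \<phi>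
  proof (cases "L2_norm \<nu> \<phi> = 0")
    case False
    then have "L2_norm \<nu> \<phi> > 0" by (simp add: less_le)
    then have "L2_norm \<nu> (T \<phi>) / L2_norm \<nu> \<phi> \<le> C"
      using C[OF that] by (simp add: divide_le_eq)
    then show ?thesis by simp
  qed simp
  then show ?thesis by (intro bdd_aboveI[where M = "max C 0"]) blast
qed

lemma operator_norm_nonneg: "0 \<le> operator_norm \<nu> T"
  unfolding operator_norm_def
  by (rule order_trans[OF _ cSUP_upper[OF L2_zero bdd_above_operator_norm]]) simp

lemma L2_norm_operator_le:
  assumes "\<phi> \<in> L2 \<nu>"
  shows "L2_norm \<nu> (T \<phi>) \<le> operator_norm \<nu> T * L2_norm \<nu> \<phi>"
proof (cases "L2_norm \<nu> \<phi> = 0")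
  \<comment> \<open>The quotient of a null vector is 0 by convention and says nothing about its
    image; the bound C does.\<close>
  case True
  obtain C where "L2_norm \<nu> (T \<phi>) \<le> C * L2_norm \<nu> \<phi>"
    using T assms unfolding bounded_operator_def by blast
  then show ?thesis using True by simp
next
  case False
  then have "L2_norm \<nu> \<phi> > 0" by (simp add: less_le)
  moreover have "L2_norm \<nu> (T \<phi>) / L2_norm \<nu> \<phi> \<le> operator_norm \<nu> T"
    unfolding operator_norm_def by (rule cSUP_upper[OF assms bdd_above_operator_norm])
  ultimately show ?thesis by (simp add: divide_le_eq)
qed

lemma operator_norm_witness:
  assumes "0 \<le> s" "s < operator_norm \<nu> T"
  obtains \<phi> where "\<phi> \<in> L2 \<nu>" "0 < L2_norm \<nu> \<phi>" "s * L2_norm \<nu> \<phi> < L2_norm \<nu> (T \<phi>)"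
proof -
  have "L2 \<nu> \<noteq> ({} :: ('a \<Rightarrow> 'h) set)" using L2_zero by blast
  then obtain \<phi> where \<phi>: "\<phi> \<in> L2 \<nu>" "s < L2_norm \<nu> (T \<phi>) / L2_norm \<nu> \<phi>"
    using assms(2) less_cSUP_iff[OF _ bdd_above_operator_norm] unfolding operator_norm_def by blast
  \<comment> \<open>A null vector has quotient 0, which does not exceed s.\<close>
  then have "L2_norm \<nu> \<phi> \<noteq> 0" using assms(1) by auto
  then have "0 < L2_norm \<nu> \<phi>" by (simp add: less_le)
  with \<phi> that show ?thesis by (simp add: less_divide_eq)
qed

text \<open>Splittings by cutoffs hold only on \<open>space \<nu>\<close>, and T respects sums only
  almost everywhere; so \<theta> is a separate function rather than the literal sum.\<close>

lemma L2_norm_operator_triangle: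
  assumes "\<phi> \<in> L2 \<nu>" "\<psi> \<in> L2 \<nu>" and "\<And>x. x \<in> space \<nu> \<Longrightarrow> \<theta> x = \<phi> x + \<psi> x" and "\<theta> \<in> L2 \<nu>"
  shows "L2_norm \<nu> (T \<theta>) \<le> L2_norm \<nu> (T \<phi>) + L2_norm \<nu> (T \<psi>)"
    and "AE x in \<nu>. T \<theta> x = T \<phi> x + T \<psi> x"
proof -
  have "AE x in \<nu>. T \<theta> x = T (\<lambda>y. \<phi> y + \<psi> y) x"
    using assms by (intro bounded_operator_cong[OF T]) auto
  with bounded_operator_add[OF T assms(1,2)]
  show ae: "AE x in \<nu>. T \<theta> x = T \<phi> x + T \<psi> x" by auto
  have "L2_norm \<nu> (T \<theta>) = L2_norm \<nu> (\<lambda>x. T \<phi> x + T \<psi> x)"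
    using ae assms bounded_operator_L2[OF T] by (intro L2_norm_cong_AE) (auto intro: L2_measurable)
  also have "\<dots> \<le> L2_norm \<nu> (T \<phi>) + L2_norm \<nu> (T \<psi>)"
    using assms bounded_operator_L2[OF T] by (intro L2_norm_triangle) auto
  finally show "L2_norm \<nu> (T \<theta>) \<le> L2_norm \<nu> (T \<phi>) + L2_norm \<nu> (T \<psi>)" .
qed

end

section \<open>Operators of finite propagation\<close>

context
  fixes \<nu> :: "'a::metric_space measure" and k :: real
    and T :: "('a \<Rightarrow> 'h::{complex_hilbert,second_countable_topology}) \<Rightarrow> ('a \<Rightarrow> 'h)"
  assumes T: "T \<in> propagation_at_most k \<nu>"
begin

lemma T_bounded: "bounded_operator \<nu> T"
  using T by (simp add: propagation_at_most_def)

text \<open>Test the image against its own cutoff to U: the inner product is the squared norm of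
  that cutoff, and finite propagation makes it 0. The condition is phrased with supports so that it
  also applies to empty ones.\<close>

lemma propagation_vanish_Supp:
  assumes "\<phi> \<in> L2 \<nu>" "U \<in> sets \<nu>"
    and "ereal k < set_distance (Supp \<nu> \<phi>) (Supp \<nu> (cutoff U (T \<phi>)))"
  shows "AE x in \<nu>. x \<in> U \<longrightarrow> T \<phi> x = 0"
proof -
  have L2: "cutoff U (T \<phi>) \<in> L2 \<nu>"
    using assms bounded_operator_L2[OF T_bounded] by auto
  have "0 = L2_inner \<nu> (T \<phi>) (cutoff U (T \<phi>))"
    using T assms L2 by (simp add: propagation_at_most_def)
  also have "\<dots> = (\<integral>x. complex_of_real ((norm (cutoff U (T \<phi>) x))\<^sup>2) \<partial>\<nu>)"
    unfolding L2_inner_def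
    by (rule Bochner_Integration.integral_cong)
      (auto simp: indicator_def cinner.zero_right cinner_self)
  also have "\<dots> = complex_of_real ((L2_norm \<nu> (cutoff U (T \<phi>)))\<^sup>2)"
    unfolding L2_norm_power2 by (rule integral_complex_of_real)
  finally have "L2_norm \<nu> (cutoff U (T \<phi>)) = 0" by simp
  then show ?thesis
    using L2_norm_eq_0_iff[OF L2] by (auto simp: indicator_def elim!: eventually_mono)
qed

lemma propagation_vanish:
  assumes "\<phi> \<in> L2 \<nu>" "\<And>x. x \<in> space \<nu> \<Longrightarrow> x \<notin> A \<Longrightarrow> \<phi> x = 0"
    and "U \<in> sets \<nu>" "\<And>a u. a \<in> A \<Longrightarrow> u \<in> U \<Longrightarrow> \<rho> \<le> dist a u" "k < \<rho>"
  shows "AE x in \<nu>. x \<in> U \<longrightarrow> T \<phi> x = 0"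
proof (rule propagation_vanish_Supp[OF assms(1,3)])
  have "ereal k < ereal \<rho>" using assms(5) by simp
  also have "\<dots> \<le> set_distance (Supp \<nu> \<phi>) (Supp \<nu> (cutoff U (T \<phi>)))"
    using assms(2) by (intro set_distance_closure_ge[OF assms(4)] Supp_subset_closure) auto
  finally show "ereal k < set_distance (Supp \<nu> \<phi>) (Supp \<nu> (cutoff U (T \<phi>)))" .
qed

text \<open>A neighbourhood of B of radius k+1 separates the images: the image of \<psi> vanishes
  outside it and the image of \<phi> inside it.\<close>

lemma propagation_disjoint:
  assumes "\<phi> \<in> L2 \<nu>" "\<And>x. x \<in> space \<nu> \<Longrightarrow> x \<notin> A \<Longrightarrow> \<phi> x = 0"
    and "\<psi> \<in> L2 \<nu>" "\<And>x. x \<in> space \<nu> \<Longrightarrow> x \<notin> B \<Longrightarrow> \<psi> x = 0"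
    and dist: "\<And>a b. a \<in> A \<Longrightarrow> b \<in> B \<Longrightarrow> 2 * k + 3 \<le> dist a b"
    and infdist: "\<And>S. (\<lambda>x. infdist x S) \<in> borel_measurable \<nu>"
  shows "AE x in \<nu>. T \<phi> x = 0 \<or> T \<psi> x = 0"
proof (cases "B = {}")
  \<comment> \<open>Treated apart because \<open>infdist\<close> to the empty set is 0, which would
    make U the whole space.\<close>
  case True
  have "AE x in \<nu>. x \<in> space \<nu> \<longrightarrow> T \<psi> x = 0"
    using True assms(4) by (intro propagation_vanish[OF assms(3), where A = "{}" and \<rho> = "k + 1"]) auto
  then show ?thesis using AE_space by eventually_elim auto
next
  case False
  \<comment> \<open>A point of U has a point of B at distance below k+2, so its distance to A
    exceeds (2k+3)-(k+2) = k+1, more than the propagation.\<close>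
  define U where "U = {x \<in> space \<nu>. infdist x B \<le> k + 1}"
  have U: "U \<in> sets \<nu>"
    unfolding U_def using infdist by measurable
  have "AE x in \<nu>. x \<in> U \<longrightarrow> T \<phi> x = 0"
  proof (rule propagation_vanish[OF assms(1,2) U, where \<rho> = "k + 1"])
    fix a u assume "a \<in> A" "u \<in> U"
    then have "infdist u B < k + 2" by (simp add: U_def)
    then obtain b where b: "b \<in> B" "dist u b < k + 2"
      by (rule infdist_lessE[OF False])
    then show "k + 1 \<le> dist a u"
      using dist[OF \<open>a \<in> A\<close> b(1)] dist_triangle[of a b u] by linarith
  qed auto
  moreover have "AE x in \<nu>. x \<in> space \<nu> - U \<longrightarrow> T \<psi> x = 0"
  proof (rule propagation_vanish[OF assms(3,4), where \<rho> = "k + 1"])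
    fix b u assume "b \<in> B" "u \<in> space \<nu> - U"
    then show "k + 1 \<le> dist b u"
      using infdist_le[of b B u] by (auto simp: U_def dist_commute)
  qed (use U in auto)
  ultimately show ?thesis using AE_space by eventually_elim auto
qed

text \<open>Pythagoras holds for the two pieces and also for their images, so a common bound s on
  the pieces passes to the whole. It is used by contraposition: if T exceeds the factor s on \<phi>,
  it does so on one piece.\<close>

lemma propagation_union_le:
  assumes "\<phi> \<in> L2 \<nu>" "\<And>x. x \<in> space \<nu> \<Longrightarrow> x \<notin> A \<union> B \<Longrightarrow> \<phi> x = 0"
    and "A \<in> sets \<nu>" "B \<in> sets \<nu>" "0 \<le> k" "0 \<le> s"
    and dist: "\<And>a b. a \<in> A \<Longrightarrow> b \<in> B \<Longrightarrow> 2 * k + 3 \<le> dist a b"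
    and infdist: "\<And>S. (\<lambda>x. infdist x S) \<in> borel_measurable \<nu>"
    and le: "L2_norm \<nu> (T (cutoff A \<phi>)) \<le> s * L2_norm \<nu> (cutoff A \<phi>)"
      "L2_norm \<nu> (T (cutoff B \<phi>)) \<le> s * L2_norm \<nu> (cutoff B \<phi>)"
  shows "L2_norm \<nu> (T \<phi>) \<le> s * L2_norm \<nu> \<phi>"
proof -
  have cut: "cutoff A \<phi> \<in> L2 \<nu>" "cutoff B \<phi> \<in> L2 \<nu>"
    using assms by auto
  have [measurable]: "\<phi> \<in> borel_measurable \<nu>" using assms(1) by (rule L2_measurable)
  have disj: "A \<inter> B = {}"
    using dist \<open>0 \<le> k\<close> by fastforce
  have sum: "\<phi> x = cutoff A \<phi> x + cutoff B \<phi> x" if "x \<in> space \<nu>" for x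
    using assms(2)[OF that] disj by (auto simp: indicator_def)
  have "L2_norm \<nu> (T \<phi>) = L2_norm \<nu> (\<lambda>x. T (cutoff A \<phi>) x + T (cutoff B \<phi>) x)"
    using L2_norm_operator_triangle(2)[OF T_bounded cut sum assms(1)]
      bounded_operator_L2[OF T_bounded] cut assms(1)
    by (intro L2_norm_cong_AE) (auto intro: L2_measurable)
  moreover have "AE x in \<nu>. T (cutoff A \<phi>) x = 0 \<or> T (cutoff B \<phi>) x = 0"
    by (rule propagation_disjoint[OF cut(1) _ cut(2) _ dist infdist]) auto
  ultimately have "(L2_norm \<nu> (T \<phi>))\<^sup>2 = (L2_norm \<nu> (T (cutoff A \<phi>)))\<^sup>2 + (L2_norm \<nu> (T (cutoff B \<phi>)))\<^sup>2"
    using cut bounded_operator_L2[OF T_bounded] by (simp add: L2_norm_disjoint)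
  also have "\<dots> \<le> (s * L2_norm \<nu> (cutoff A \<phi>))\<^sup>2 + (s * L2_norm \<nu> (cutoff B \<phi>))\<^sup>2"
    using le by (intro add_mono power_mono) auto
  also have "\<dots> = s\<^sup>2 * ((L2_norm \<nu> (cutoff A \<phi>))\<^sup>2 + (L2_norm \<nu> (cutoff B \<phi>))\<^sup>2)"
    by (simp add: power_mult_distrib algebra_simps)
  also have "(L2_norm \<nu> (cutoff A \<phi>))\<^sup>2 + (L2_norm \<nu> (cutoff B \<phi>))\<^sup>2
      = (L2_norm \<nu> (\<lambda>x. cutoff A \<phi> x + cutoff B \<phi> x))\<^sup>2"
    using disj by (intro L2_norm_disjoint[symmetric] cut) (auto simp: indicator_def)
  also have "L2_norm \<nu> (\<lambda>x. cutoff A \<phi> x + cutoff B \<phi> x) = L2_norm \<nu> \<phi>"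
    using sum assms(3,4) by (intro L2_norm_cong_AE) auto
  finally have "(L2_norm \<nu> (T \<phi>))\<^sup>2 \<le> (s * L2_norm \<nu> \<phi>)\<^sup>2"
    by (simp add: power_mult_distrib)
  then show ?thesis
    by (rule power2_le_imp_le) (use \<open>0 \<le> s\<close> in simp)
qed

lemma propagation_finite_union_le:
  assumes "finite J" "\<phi> \<in> L2 \<nu>" "\<And>x. x \<in> space \<nu> \<Longrightarrow> x \<notin> (\<Union>i\<in>J. B i) \<Longrightarrow> \<phi> x = 0"
    and "\<And>i. i \<in> J \<Longrightarrow> B i \<in> sets \<nu>" "0 \<le> k" "0 \<le> s"
    and dist: "\<And>i j a b. i \<in> J \<Longrightarrow> j \<in> J \<Longrightarrow> i \<noteq> j \<Longrightarrow> a \<in> B i \<Longrightarrow> b \<in> B j \<Longrightarrow> 2 * k + 3 \<le> dist a b"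
    and infdist: "\<And>S. (\<lambda>x. infdist x S) \<in> borel_measurable \<nu>"
    and le: "\<And>i. i \<in> J \<Longrightarrow> L2_norm \<nu> (T (cutoff (B i) \<phi>)) \<le> s * L2_norm \<nu> (cutoff (B i) \<phi>)"
  shows "L2_norm \<nu> (T \<phi>) \<le> s * L2_norm \<nu> \<phi>"
  using assms(1,2,3,4) dist le
proof (induction J arbitrary: \<phi>)
  case empty
  have "L2_norm \<nu> \<phi> = 0"
    using L2_norm_eq_0_iff[OF empty.prems(1)] empty.prems(2) by auto
  then show ?case
    using L2_norm_operator_le[OF T_bounded empty.prems(1)] by simp
next
  case (insert i J)
  let ?R = "\<Union>j\<in>J. B j"
  have R: "?R \<in> sets \<nu>" using insert.hyps insert.prems(3) by auto
  show ?case
  proof (rule propagation_union_le[where A = "B i" and B = ?R])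
    show "L2_norm \<nu> (T (cutoff ?R \<phi>)) \<le> s * L2_norm \<nu> (cutoff ?R \<phi>)"
    proof (rule insert.IH)
      show "L2_norm \<nu> (T (cutoff (B j) (cutoff ?R \<phi>))) \<le> s * L2_norm \<nu> (cutoff (B j) (cutoff ?R \<phi>))" if "j \<in> J" for j
      proof -
        have "cutoff (B j) (cutoff ?R \<phi>) = cutoff (B j) \<phi>"
          using that by (auto simp: indicator_def fun_eq_iff)
        then show ?thesis using insert.prems(5)[of j] that by simp
      qed
      show "2 * k + 3 \<le> dist a b" if "j \<in> J" "j' \<in> J" "j \<noteq> j'" "a \<in> B j" "b \<in> B j'" for j j' a b
        using insert.prems(4)[of j j' a b] that by blast
    qed (use insert.prems(1,3) R in auto)
    show "2 * k + 3 \<le> dist a b" if "a \<in> B i" "b \<in> ?R" for a b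
    proof -
      obtain j where "j \<in> J" "b \<in> B j" using \<open>b \<in> ?R\<close> by blast
      then show ?thesis
        using insert.prems(4)[of i j a b] insert.hyps(2) that(1) by blast
    qed
  qed (use insert.prems(1,2,3,5) R infdist \<open>0 \<le> k\<close> \<open>0 \<le> s\<close> in auto)
qed

end

section \<open>Exhaustion by finitely many balls\<close>

lemma space_Int_closed_sets:
  assumes "sets \<nu> = sets (restrict_space borel X)" "closed C"
  shows "space \<nu> \<inter> C \<in> sets \<nu>"
proof -
  have "space \<nu> = X"
    using sets_eq_imp_space_eq[OF assms(1)] by (simp add: space_restrict_space)
  then show ?thesis
    using assms by (auto simp: sets_restrict_space)
qed

lemma infdist_borel_measurable:
  assumes "sets \<nu> = sets (restrict_space borel X)"
  shows "(\<lambda>x. infdist x S) \<in> borel_measurable \<nu>"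
proof -
  have "(\<lambda>x. infdist x S) \<in> borel_measurable (restrict_space borel X)"
    by (intro measurable_restrict_space1 borel_measurable_continuous_onI continuous_intros)
  then show ?thesis
    by (simp cong: measurable_cong_sets add: measurable_cong_sets[OF assms refl])
qed

lemma L2_norm_cutoff_power2:
  "(L2_norm \<nu> (cutoff B \<phi>))\<^sup>2 = set_lebesgue_integral \<nu> B (\<lambda>x. (norm (\<phi> x))\<^sup>2)"
proof -
  have "(norm (cutoff B \<phi> x))\<^sup>2 = indicator B x *\<^sub>R (norm (\<phi> x))\<^sup>2" for x
    by (auto simp: indicator_def)
  then show ?thesis by (simp add: L2_norm_power2 set_lebesgue_integral_def)
qed

lemma L2_norm_cutoff_Un:
  assumes "\<phi> \<in> L2 \<nu>" "A \<in> sets \<nu>" "B \<in> sets \<nu>" "A \<inter> B = {}"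
  shows "(L2_norm \<nu> (cutoff (A \<union> B) \<phi>))\<^sup>2 = (L2_norm \<nu> (cutoff A \<phi>))\<^sup>2 + (L2_norm \<nu> (cutoff B \<phi>))\<^sup>2"
proof -
  have "cutoff (A \<union> B) \<phi> = (\<lambda>x. cutoff A \<phi> x + cutoff B \<phi> x)"
    using assms(4) by (auto simp: indicator_def fun_eq_iff)
  moreover have "(L2_norm \<nu> (\<lambda>x. cutoff A \<phi> x + cutoff B \<phi> x))\<^sup>2
      = (L2_norm \<nu> (cutoff A \<phi>))\<^sup>2 + (L2_norm \<nu> (cutoff B \<phi>))\<^sup>2"
    using assms(4) by (intro L2_norm_disjoint L2_cutoff assms AE_I2) (auto simp: indicator_def)
  ultimately show ?thesis by simp
qed

lemma L2_norm_cutoff_mono: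
  assumes "\<phi> \<in> L2 \<nu>" "A \<in> sets \<nu>" "B \<in> sets \<nu>" "A \<subseteq> B"
  shows "L2_norm \<nu> (cutoff A \<phi>) \<le> L2_norm \<nu> (cutoff B \<phi>)"
  using assms(4) by (intro L2_norm_mono L2_cutoff assms) (auto simp: indicator_def)

text \<open>Closed balls make these finite unions closed, hence measurable for the trace
  \<sigma>-algebra.\<close>

abbreviation unit_balls :: "'a::metric_space measure \<Rightarrow> 'a set \<Rightarrow> 'a set" where
  "unit_balls \<nu> F \<equiv> space \<nu> \<inter> (\<Union>y\<in>F. cball y 1)"

text \<open>No separability is available, so \<open>\<phi>\<close> need not be concentrated on countably many balls. But a
  countable union \<open>P\<close> of balls that carries the maximal amount of \<open>\<phi>\<close> leaves a remainder that vanishes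
  on every single ball, hence has empty support and is invisible to operators of finite propagation.\<close>

lemma exhaustion_by_balls:
  fixes \<nu> :: "'a::metric_space measure"
  assumes \<nu>: "sets \<nu> = sets (restrict_space borel X)"
    and \<phi>: "\<phi> \<in> L2 \<nu>" and "0 < \<delta>"
  obtains F P where "finite F" "P \<in> sets \<nu>" "L2_norm \<nu> (cutoff (P - unit_balls \<nu> F) \<phi>) \<le> \<delta>"
    "\<And>y. AE x in \<nu>. x \<in> ball y 1 \<longrightarrow> x \<notin> P \<longrightarrow> \<phi> x = 0"
proof -
  define m where "m B = (L2_norm \<nu> (cutoff B \<phi>))\<^sup>2" for B
  have balls: "unit_balls \<nu> F \<in> sets \<nu>" if "finite F" for F
    using that by (intro space_Int_closed_sets[OF \<nu>]) auto
  have m_mono: "m A \<le> m B" if "A \<in> sets \<nu>" "B \<in> sets \<nu>" "A \<subseteq> B" for A B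
    unfolding m_def by (rule power_mono[OF L2_norm_cutoff_mono[OF \<phi> that]]) simp
  have m_le: "m B \<le> m (space \<nu>)" if "B \<in> sets \<nu>" for B
    by (rule m_mono[OF that sets.top sets.sets_into_space[OF that]])
  have bdd: "bdd_above ((\<lambda>F. m (unit_balls \<nu> F)) ` Collect finite)"
    by (rule bdd_aboveI[where M = "m (space \<nu>)"]) (auto simp: m_le balls)
  \<comment> \<open>The maximal mass, as a supremum over finite unions of balls; a countable union
    will attain it.\<close>
  define s where "s = (SUP F\<in>Collect finite. m (unit_balls \<nu> F))"
  have le_s: "m (unit_balls \<nu> F) \<le> s" if "finite F" for F
    unfolding s_def using that by (intro cSUP_upper bdd) auto
  have "\<exists>F. finite F \<and> s - 1 / real (Suc n) < m (unit_balls \<nu> F)" for n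
  proof -
    have "s - 1 / real (Suc n) < s" by simp
    then show ?thesis
      unfolding s_def by (subst (asm) less_cSUP_iff[OF _ bdd]) auto
  qed
  then obtain G where G: "\<And>n. finite (G n)" "\<And>n. s - 1 / real (Suc n) < m (unit_balls \<nu> (G n))"
    by metis
  define P where "P = (\<Union>n. unit_balls \<nu> (G n))"
  have P: "P \<in> sets \<nu>" unfolding P_def by (intro sets.countable_UN image_subsetI balls G(1))
  \<comment> \<open>Adding finitely many balls to P still gives an increasing limit of finite
    unions, so the mass stays at most s.\<close>
  have up: "m (P \<union> unit_balls \<nu> K) \<le> s" if "finite K" for K
  proof -
    define R where "R n = unit_balls \<nu> (K \<union> (\<Union>i\<le>n. G i))" for n
    have R: "R n \<in> sets \<nu>" "m (R n) \<le> s" for n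
      unfolding R_def using that G(1) by (intro balls le_s finite_UnI finite_UN_I; simp)+
    have UR: "(\<Union>n. R n) = P \<union> unit_balls \<nu> K"
      unfolding R_def P_def by blast
    have "(\<lambda>n. m (R n)) \<longlonglongrightarrow> m (\<Union>n. R n)"
      unfolding m_def L2_norm_cutoff_power2
    proof (rule set_integral_cont_up)
      show "incseq R" unfolding R_def by (rule incseq_SucI) (auto simp: le_Suc_eq)
      show "set_integrable \<nu> (\<Union>n. R n) (\<lambda>x. (norm (\<phi> x))\<^sup>2)"
        unfolding set_integrable_def
        using L2_integrable[OF \<phi>] R by (intro integrable_mult_indicator) auto
    qed (use R in auto)
    then show ?thesis
      unfolding UR[symmetric] by (rule LIMSEQ_le_const2) (use R in auto)
  qed
  have "s \<le> m P"
  proof (rule field_le_epsilon)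
    fix e :: real assume "0 < e"
    then obtain n where "1 / real (Suc n) < e" using nat_approx_posE by metis
    moreover have "m (unit_balls \<nu> (G n)) \<le> m P"
      using P balls G by (intro m_mono) (auto simp: P_def)
    ultimately show "s \<le> m P + e" using G(2)[of n] by linarith
  qed
  \<comment> \<open>P already has mass s, so by \<open>up\<close> one more ball cannot add
    any.\<close>
  have vanish: "AE x in \<nu>. x \<in> ball y 1 \<longrightarrow> x \<notin> P \<longrightarrow> \<phi> x = 0" for y
  proof -
    let ?B = "unit_balls \<nu> {y} - P"
    have B: "?B \<in> sets \<nu>" using balls[of "{y}"] P by auto
    have "m (P \<union> ?B) = m P + m ?B"
      unfolding m_def using P B by (intro L2_norm_cutoff_Un \<phi>) auto
    moreover have "P \<union> ?B = P \<union> unit_balls \<nu> {y}" by blast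
    ultimately have "m ?B \<le> 0" using up[of "{y}"] \<open>s \<le> m P\<close> by simp
    then have "L2_norm \<nu> (cutoff ?B \<phi>) = 0" by (simp add: m_def)
    then have "AE x in \<nu>. cutoff ?B \<phi> x = 0"
      using L2_norm_eq_0_iff[OF L2_cutoff[OF \<phi> B]] by simp
    then show ?thesis
      using AE_space by eventually_elim (auto simp: indicator_def)
  qed
  obtain n where n: "1 / real (Suc n) < \<delta>\<^sup>2"
    using nat_approx_posE[of "\<delta>\<^sup>2"] \<open>0 < \<delta>\<close> by auto
  let ?Q = "unit_balls \<nu> (G n)"
  have "m (?Q \<union> (P - ?Q)) = m ?Q + m (P - ?Q)"
    unfolding m_def using P balls[OF G(1)] by (intro L2_norm_cutoff_Un \<phi>) auto
  \<comment> \<open>Written with an empty family of balls so that \<open>up\<close> bounds the mass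
    of P itself. As \<open>?Q\<close> carries more than s-\<delta>^2, little is left for the rest of
    P.\<close>
  moreover have "?Q \<union> (P - ?Q) = P \<union> unit_balls \<nu> {}"
    unfolding P_def by blast
  ultimately have "m (P - ?Q) \<le> \<delta>\<^sup>2"
    using up[of "{}"] G(2)[of n] n by simp
  then have "L2_norm \<nu> (cutoff (P - ?Q) \<phi>) \<le> \<delta>"
    unfolding m_def by (rule power2_le_imp_le) (use \<open>0 < \<delta>\<close> in simp)
  with that[OF G(1) P _ vanish] show ?thesis .
qed

text \<open>Such a \<phi> need not vanish almost everywhere: without separability, uncountably many
  null balls may cover a set of positive measure.\<close>

lemma Supp_empty:
  fixes \<nu> :: "'a::metric_space measure"
  assumes "\<And>y. AE x in \<nu>. x \<in> ball y 1 \<longrightarrow> \<phi> x = 0"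
  shows "Supp \<nu> \<phi> = {}"
proof -
  have "y \<in> \<Union>{U. open U \<and> (AE x in \<nu>. x \<in> U \<longrightarrow> \<phi> x = 0)}" for y
    using assms[of y] by (intro UnionI[of "ball y 1"]) auto
  then show ?thesis by (auto simp: Supp_def)
qed

lemma set_distance_empty: "ereal r < set_distance {} S" "ereal r < set_distance S {}"
  by (simp_all add: set_distance_def top_ereal_def)

context
  fixes \<nu> :: "'a::metric_space measure" and k :: real and X :: "'a set"
    and T :: "('a \<Rightarrow> 'h::{complex_hilbert,second_countable_topology}) \<Rightarrow> ('a \<Rightarrow> 'h)"
  assumes \<nu>: "sets \<nu> = sets (restrict_space borel X)"
    and T: "T \<in> propagation_at_most k \<nu>"
begin

text \<open>Off Q, the part of \<phi> inside P is small, and the part outside P has empty support.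
  The empty set is infinitely far from everything, so T annihilates the latter. Any larger Q is
  allowed because several families of balls get combined later.\<close>

lemma operator_exhaustion:
  assumes \<phi>: "\<phi> \<in> L2 \<nu>" and "0 < \<delta>"
  obtains F where "finite F"
    "\<And>Q. Q \<in> sets \<nu> \<Longrightarrow> unit_balls \<nu> F \<subseteq> Q \<Longrightarrow> L2_norm \<nu> (T (cutoff (space \<nu> - Q) \<phi>)) \<le> \<delta>"
proof -
  note bop = T_bounded[OF T]
  define t where "t = operator_norm \<nu> T"
  have "0 \<le> t" unfolding t_def by (rule operator_norm_nonneg[OF bop])
  \<comment> \<open>The denominator t+1 avoids dividing by zero when T has norm 0.\<close>
  have pos: "0 < \<delta> / (t + 1)" using \<open>0 < \<delta>\<close> \<open>0 \<le> t\<close> by simp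
  obtain F P where F: "finite F" "P \<in> sets \<nu>"
    "L2_norm \<nu> (cutoff (P - unit_balls \<nu> F) \<phi>) \<le> \<delta> / (t + 1)"
    "\<And>y. AE x in \<nu>. x \<in> ball y 1 \<longrightarrow> x \<notin> P \<longrightarrow> \<phi> x = 0"
    by (rule exhaustion_by_balls[OF \<nu> \<phi> pos]) blast
  show ?thesis
  proof (rule that[OF F(1)])
    fix Q assume Q: "Q \<in> sets \<nu>" "unit_balls \<nu> F \<subseteq> Q"
    let ?\<theta> = "cutoff (space \<nu> - Q - P) \<phi>"
    have \<theta>: "?\<theta> \<in> L2 \<nu>" using \<phi> Q F by auto
    have "Supp \<nu> ?\<theta> = {}"
    proof (rule Supp_empty)
      show "AE x in \<nu>. x \<in> ball y 1 \<longrightarrow> ?\<theta> x = 0" for y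
        using F(4)[of y] by eventually_elim (auto simp: indicator_def)
    qed
    then have "AE x in \<nu>. x \<in> space \<nu> \<longrightarrow> T ?\<theta> x = 0"
      by (intro propagation_vanish_Supp[OF T \<theta>]) (auto simp: set_distance_empty)
    then have "L2_norm \<nu> (T ?\<theta>) = 0"
      using L2_norm_eq_0_iff[OF bounded_operator_L2[OF bop \<theta>]] AE_space by auto
    moreover have "L2_norm \<nu> (T (cutoff (P - Q) \<phi>)) \<le> \<delta>"
    proof -
      have balls: "unit_balls \<nu> F \<in> sets \<nu>"
        using F(1) by (intro space_Int_closed_sets[OF \<nu>]) auto
      have "L2_norm \<nu> (T (cutoff (P - Q) \<phi>)) \<le> t * L2_norm \<nu> (cutoff (P - Q) \<phi>)"
        unfolding t_def using \<phi> Q F by (intro L2_norm_operator_le[OF bop]) auto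
      also have "\<dots> \<le> t * (\<delta> / (t + 1))"
        using \<phi> Q F balls \<open>0 \<le> t\<close>
        by (intro mult_left_mono order_trans[OF L2_norm_cutoff_mono F(3)]) auto
      also have "\<dots> \<le> \<delta>"
        using \<open>0 \<le> t\<close> \<open>0 < \<delta>\<close> by (simp add: field_simps)
      finally show ?thesis .
    qed
    moreover have "L2_norm \<nu> (T (cutoff (space \<nu> - Q) \<phi>))
        \<le> L2_norm \<nu> (T ?\<theta>) + L2_norm \<nu> (T (cutoff (P - Q) \<phi>))"
      using \<phi> Q F(2) sets.sets_into_space[OF F(2)]
      by (intro L2_norm_operator_triangle[OF bop \<theta>] L2_cutoff sets.Diff sets.top) (auto simp: indicator_def)
    ultimately show "L2_norm \<nu> (T (cutoff (space \<nu> - Q) \<phi>)) \<le> \<delta>" by linarith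
  qed
qed

text \<open>The counterpart for the image, needed because the matrix must have finitely many rows as
  well as columns. Here the part outside P has empty support, so the propagation condition makes it
  orthogonal to the image itself and hence null.\<close>

lemma image_exhaustion:
  assumes \<phi>: "\<phi> \<in> L2 \<nu>" and "0 < \<delta>"
  obtains F where "finite F"
    "\<And>Q. Q \<in> sets \<nu> \<Longrightarrow> unit_balls \<nu> F \<subseteq> Q \<Longrightarrow> L2_norm \<nu> (cutoff (space \<nu> - Q) (T \<phi>)) \<le> \<delta>"
proof -
  note T\<phi> = bounded_operator_L2[OF T_bounded[OF T] \<phi>]
  obtain F P where F: "finite F" "P \<in> sets \<nu>"
    "L2_norm \<nu> (cutoff (P - unit_balls \<nu> F) (T \<phi>)) \<le> \<delta>"
    "\<And>y. AE x in \<nu>. x \<in> ball y 1 \<longrightarrow> x \<notin> P \<longrightarrow> T \<phi> x = 0"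
    by (rule exhaustion_by_balls[OF \<nu> T\<phi> \<open>0 < \<delta>\<close>]) blast
  show ?thesis
  proof (rule that[OF F(1)])
    fix Q assume Q: "Q \<in> sets \<nu>" "unit_balls \<nu> F \<subseteq> Q"
    let ?U = "space \<nu> - Q - P"
    have U: "?U \<in> sets \<nu>" using Q F by auto
    have balls: "unit_balls \<nu> F \<in> sets \<nu>"
      using F(1) by (intro space_Int_closed_sets[OF \<nu>]) auto
    have "Supp \<nu> (cutoff ?U (T \<phi>)) = {}"
    proof (rule Supp_empty)
      show "AE x in \<nu>. x \<in> ball y 1 \<longrightarrow> cutoff ?U (T \<phi>) x = 0" for y
        using F(4)[of y] by eventually_elim (auto simp: indicator_def)
    qed
    then have "AE x in \<nu>. x \<in> ?U \<longrightarrow> T \<phi> x = 0"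
      by (intro propagation_vanish_Supp[OF T \<phi> U]) (simp add: set_distance_empty)
    then have "AE x in \<nu>. cutoff (space \<nu> - Q) (T \<phi>) x = cutoff (P - Q) (T \<phi>) x"
      using AE_space by eventually_elim (auto simp: indicator_def)
    then have "L2_norm \<nu> (cutoff (space \<nu> - Q) (T \<phi>)) = L2_norm \<nu> (cutoff (P - Q) (T \<phi>))"
      using Q F T\<phi> by (intro L2_norm_cong_AE L2_measurable) auto
    also have "\<dots> \<le> \<delta>"
      using Q F balls by (intro order_trans[OF L2_norm_cutoff_mono F(3)] T\<phi>) auto
    finally show "L2_norm \<nu> (cutoff (space \<nu> - Q) (T \<phi>)) \<le> \<delta>" .
  qed
qed

end

section \<open>Counting measures on finite subsets\<close>

text \<open>A pushforward, because the localization property of Z wants a measure on all of Z with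
  the trace Borel \<sigma>-algebra, while the mass should sit on D only.\<close>

definition counting_on :: "'a::metric_space set \<Rightarrow> 'a set \<Rightarrow> 'a measure" where
  "counting_on Z D = distr (count_space D) (restrict_space borel Z) (\<lambda>x. x)"

lemma sets_counting_on [simp]: "sets (counting_on Z D) = sets (restrict_space borel Z)"
  by (simp add: counting_on_def)

lemma space_counting_on [simp]: "space (counting_on Z D) = Z"
  by (simp add: counting_on_def space_restrict_space)

context
  fixes Z D :: "'a::metric_space set"
  assumes D: "finite D" "D \<subseteq> Z"
begin

lemma measurable_id_counting_on: "(\<lambda>x. x) \<in> measurable (count_space D) (restrict_space borel Z)"
  using D by (auto simp: space_restrict_space)

lemma emeasure_counting_on:
  assumes "B \<in> sets (restrict_space borel Z)"
  shows "emeasure (counting_on Z D) B = of_nat (card (B \<inter> D))"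
proof -
  have "emeasure (counting_on Z D) B = emeasure (count_space D) (B \<inter> D)"
    unfolding counting_on_def using assms measurable_id_counting_on
    by (subst emeasure_distr) (auto simp: vimage_def Int_def)
  then show ?thesis using D by simp
qed

lemma finite_set_sets_counting_on: "S \<subseteq> D \<Longrightarrow> S \<in> sets (restrict_space borel Z)"
  using D finite_subset[of S D]
  by (auto simp: sets_restrict_space image_iff intro!: bexI[of _ S] borel_closed finite_imp_closed)

lemma AE_counting_on: "(AE x in counting_on Z D. Q x) \<longleftrightarrow> (\<forall>x\<in>D. Q x)"
proof
  assume "AE x in counting_on Z D. Q x"
  then obtain N where N: "N \<in> null_sets (counting_on Z D)" "{x \<in> Z. \<not> Q x} \<subseteq> N"
    by (auto simp: eventually_ae_filter)
  then have "card (N \<inter> D) = 0"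
    using emeasure_counting_on[of N] by (auto simp: null_sets_def)
  then show "\<forall>x\<in>D. Q x" using N(2) D by auto
next
  assume Q: "\<forall>x\<in>D. Q x"
  have "Z - D \<in> sets (restrict_space borel Z)"
    using finite_set_sets_counting_on[of D] sets.compl_sets[of D "restrict_space borel Z"]
    by (simp add: space_restrict_space)
  then have "Z - D \<in> null_sets (counting_on Z D)"
    using emeasure_counting_on[of "Z - D"] by (simp add: null_sets_def Int_commute[of _ D])
  then show "AE x in counting_on Z D. Q x"
    using Q by (auto simp: eventually_ae_filter intro!: bexI[of _ "Z - D"])
qed

lemma positive_locally_finite_counting_on:
  "D \<noteq> {} \<Longrightarrow> positive_locally_finite_borel Z (counting_on Z D)"
  unfolding positive_locally_finite_borel_def
  using D sets.top[of "restrict_space borel Z"]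
  by (auto simp: emeasure_counting_on space_restrict_space Int_absorb1 of_nat_less_top)

text \<open>Measurability concerns all of Z, so the function is prescribed off D too; it is then a
  finite combination of indicators of singletons.\<close>

lemma borel_measurable_counting_on:
  fixes \<xi> :: "'a \<Rightarrow> 'b::{second_countable_topology,real_normed_vector}"
  assumes "\<And>x. x \<notin> D \<Longrightarrow> \<xi> x = 0"
  shows "\<xi> \<in> borel_measurable (counting_on Z D)"
proof -
  have "\<xi> = (\<lambda>x. \<Sum>d\<in>D. indicator {d} x *\<^sub>R \<xi> d)"
  proof
    show "\<xi> x = (\<Sum>d\<in>D. indicator {d} x *\<^sub>R \<xi> d)" for x
      using D(1) assms[of x] by (cases "x \<in> D") (auto simp: indicator_def sum.delta' if_distrib[of "\<lambda>t. t *\<^sub>R _"] of_bool_def cong: if_cong)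
  qed
  also have "\<dots> \<in> borel_measurable (counting_on Z D)"
  proof (intro borel_measurable_sum borel_measurable_scaleR borel_measurable_indicator)
    show "{d} \<in> sets (counting_on Z D)" if "d \<in> D" for d
      using finite_set_sets_counting_on[of "{d}"] that by simp
  qed auto
  finally show ?thesis .
qed

lemma integral_counting_on:
  fixes f :: "'a \<Rightarrow> 'b::{banach,second_countable_topology}"
  assumes "f \<in> borel_measurable (counting_on Z D)"
  shows "(\<integral>x. f x \<partial>counting_on Z D) = (\<Sum>x\<in>D. f x)"
proof -
  have "f \<in> borel_measurable (restrict_space borel Z)"
    using assms by (simp cong: measurable_cong_sets)
  then show ?thesis
    unfolding counting_on_def using D(1) measurable_id_counting_on
    by (simp add: integral_distr lebesgue_integral_count_space_finite)
qed

lemma L2_counting_on: "\<xi> \<in> L2 (counting_on Z D) \<longleftrightarrow> \<xi> \<in> borel_measurable (counting_on Z D)"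
proof -
  have "integrable (counting_on Z D) (\<lambda>x. (norm (\<xi> x))\<^sup>2)" if "\<xi> \<in> borel_measurable (counting_on Z D)"
  proof -
    have "(\<lambda>x. (norm (\<xi> x))\<^sup>2) \<in> borel_measurable (restrict_space borel Z)"
      using that by (simp cong: measurable_cong_sets)
    then show ?thesis
      unfolding counting_on_def using D(1) measurable_id_counting_on
      by (simp add: integrable_distr_eq integrable_count_space)
  qed
  then show ?thesis by (auto simp: L2_iff)
qed

lemma L2_norm_counting_on:
  assumes "\<xi> \<in> L2 (counting_on Z D)"
  shows "(L2_norm (counting_on Z D) \<xi>)\<^sup>2 = (\<Sum>x\<in>D. (norm (\<xi> x))\<^sup>2)"
  unfolding L2_norm_power2 using assms by (intro integral_counting_on) (auto simp: L2_iff)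

lemma Supp_counting_on: "Supp (counting_on Z D) \<xi> = {x \<in> D. \<xi> x \<noteq> 0}"
proof
  have "Supp (counting_on Z D) \<xi> \<subseteq> space (counting_on Z D) - - {x \<in> D. \<xi> x \<noteq> 0}"
    unfolding Supp_def using D(1)
    by (intro Diff_mono order_refl Union_upper) (auto simp: AE_counting_on intro!: finite_imp_closed)
  then show "Supp (counting_on Z D) \<xi> \<subseteq> {x \<in> D. \<xi> x \<noteq> 0}" by auto
  show "{x \<in> D. \<xi> x \<noteq> 0} \<subseteq> Supp (counting_on Z D) \<xi>"
    using D by (auto simp: Supp_def AE_counting_on)
qed

end

section \<open>Transfer to a discrete model\<close>

lemma bounded_diameter_closure:
  fixes A :: "'a::metric_space set"
  assumes "\<And>x y. x \<in> A \<Longrightarrow> y \<in> A \<Longrightarrow> dist x y \<le> d" "0 \<le> d" "S \<subseteq> closure A"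
  shows "bounded S" "diameter S \<le> d"
proof -
  have "bounded A" unfolding bounded_two_points using assms(1) by blast
  then have bdd: "bounded (closure A)" by (rule bounded_closure)
  then show "bounded S" using assms(3) by (rule bounded_subset)
  have "diameter A \<le> d"
    unfolding diameter_def using assms(1,2) by (auto intro!: cSUP_least)
  then show "diameter S \<le> d"
    using diameter_subset[OF assms(3) bdd] diameter_closure[OF \<open>bounded A\<close>] by simp
qed

text \<open>For a null \<theta> the factor is 1/0 = 0, hence an inequality in place of norm
  1.\<close>

lemma L2_normalized:
  assumes "\<theta> \<in> L2 \<nu>"
  shows "(\<lambda>x. complex_of_real (1 / L2_norm \<nu> \<theta>) *\<^sub>C \<theta> x) \<in> L2 \<nu>"
    and "L2_norm \<nu> (\<lambda>x. complex_of_real (1 / L2_norm \<nu> \<theta>) *\<^sub>C \<theta> x) \<le> 1"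
  using assms by (auto simp: L2_norm_scaleC simp del: of_real_divide)

text \<open>Computes the coefficient of \<psi> along one of its own normalized pieces.\<close>

lemma L2_inner_cutoff_self:
  "L2_inner \<nu> \<psi> (\<lambda>x. complex_of_real r *\<^sub>C cutoff B \<psi> x) = complex_of_real (r * (L2_norm \<nu> (cutoff B \<psi>))\<^sup>2)"
proof -
  have "L2_inner \<nu> \<psi> (\<lambda>x. complex_of_real r *\<^sub>C cutoff B \<psi> x)
      = (\<integral>x. complex_of_real (r * (norm (cutoff B \<psi> x))\<^sup>2) \<partial>\<nu>)"
    unfolding L2_inner_def
    by (rule Bochner_Integration.integral_cong)
      (auto simp: indicator_def cinner_scaleC_right scaleC_zero_right cinner.zero_right cinner_self)
  also have "\<dots> = complex_of_real (r * (L2_norm \<nu> (cutoff B \<psi>))\<^sup>2)"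
    unfolding integral_complex_of_real L2_norm_power2 by simp
  finally show ?thesis .
qed

text \<open>Compressing \<open>T\<close> to the lines spanned by the pieces of \<open>\<phi>\<close> and of \<open>T \<phi>\<close> gives a finite matrix,
  which acts on the functions on \<open>D \<subseteq> Z\<close> through a single unit vector of \<open>H\<close>. A vector that
  localizes the matrix is carried back to one that localizes \<open>T\<close>.\<close>

lemma localization_transfer:
  fixes \<nu> :: "'a::metric_space measure" and k M :: nat and f :: "nat \<Rightarrow> nat"
    and T :: "('a \<Rightarrow> 'h::{complex_hilbert,second_countable_topology}) \<Rightarrow> ('a \<Rightarrow> 'h)"
    and P :: "'a \<Rightarrow> 'a set" and h :: 'h
  assumes T: "T \<in> propagation_at_most (real k) \<nu>"
    and onl: "onl_with TYPE('h) Z c f" and "0 < c"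
    and D: "finite D" "D \<subseteq> Z"
    and P: "\<And>y. y \<in> D \<Longrightarrow> P y \<in> sets \<nu>" "disjoint_family_on P D" "\<And>y. y \<in> D \<Longrightarrow> P y \<subseteq> cball y (real M)"
    and \<phi>: "\<phi> \<in> L2 \<nu>" and h: "norm h = 1"
    and PP: "PP = (\<Union>y\<in>D. P y)"
    and pos: "0 < L2_norm \<nu> (cutoff PP (T (cutoff PP \<phi>)))"
  obtains \<theta> where "\<theta> \<in> L2 \<nu>" "\<not> (AE x in \<nu>. \<theta> x = 0)" "bounded (Supp \<nu> \<theta>)"
    "diameter (Supp \<nu> \<theta>) \<le> real (f (k + 2 * M + 1)) + 2 * real M"
    "c * L2_norm \<nu> (cutoff PP (T (cutoff PP \<phi>))) * L2_norm \<nu> \<theta> \<le> L2_norm \<nu> (T \<theta>) * L2_norm \<nu> (cutoff PP \<phi>)"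
proof -
  note bop = T_bounded[OF T]
  note T_L2 = bounded_operator_L2[OF bop]
  have PP_sets: "PP \<in> sets \<nu>" unfolding PP using D P by auto
  define \<psi> where "\<psi> = T (cutoff PP \<phi>)"
  have \<psi>: "\<psi> \<in> L2 \<nu>" unfolding \<psi>_def using \<phi> PP_sets by (intro T_L2) auto
  define n where "n z = L2_norm \<nu> (cutoff (P z) \<phi>)" for z
  define n' where "n' y = L2_norm \<nu> (cutoff (P y) \<psi>)" for y
  \<comment> \<open>The vectors \<open>e z\<close> span the columns of the matrix and the vectors
    \<open>g y\<close> its rows; null pieces give the zero function.\<close>
  define e where "e z = (\<lambda>x. complex_of_real (1 / n z) *\<^sub>C cutoff (P z) \<phi> x)" for z
  define g where "g y = (\<lambda>x. complex_of_real (1 / n' y) *\<^sub>C cutoff (P y) \<psi> x)" for y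
  have e: "e z \<in> L2 \<nu>" "L2_norm \<nu> (e z) \<le> 1" if "z \<in> D" for z
    unfolding e_def n_def using that P(1) \<phi> by (intro L2_normalized L2_cutoff; simp)+
  have g: "g y \<in> L2 \<nu>" "L2_norm \<nu> (g y) \<le> 1" if "y \<in> D" for y
    unfolding g_def n'_def using that P(1) \<psi> by (intro L2_normalized L2_cutoff; simp)+
  have e0: "e z x = 0" if "x \<notin> P z" for x z
    using that by (simp add: e_def scaleC_zero_right)
  have g0: "g y x = 0" if "x \<notin> P y" for x y
    using that by (simp add: g_def scaleC_zero_right)
  \<comment> \<open>E reads the component of \<open>\<xi> z\<close> along h as the coefficient of
    \<open>e z\<close>. It is a contraction, and it depends only on the values on D.\<close>
  define E where "E \<xi> = (\<lambda>x. \<Sum>z\<in>D. cinner (\<xi> z) h *\<^sub>C e z x)" for \<xi> :: "'a \<Rightarrow> 'h"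
  have E_L2: "E \<xi> \<in> L2 \<nu>" for \<xi>
    unfolding E_def using e by (intro L2_sum L2_scaleC) auto
  have E_on: "E \<xi> x = cinner (\<xi> z) h *\<^sub>C e z x" if "z \<in> D" "x \<in> P z" for \<xi> z x
  proof -
    have "e z' x = 0" if "z' \<in> D - {z}" for z'
      using that \<open>z \<in> D\<close> \<open>x \<in> P z\<close> P(2) by (intro e0) (auto simp: disjoint_family_on_def)
    then show ?thesis
      unfolding E_def using D(1) \<open>z \<in> D\<close> by (subst sum.remove[of _ z]) (auto simp: scaleC_zero_right)
  qed
  have E_off: "E \<xi> x = 0" if "x \<notin> (\<Union>z\<in>{z \<in> D. \<xi> z \<noteq> 0}. P z)" for \<xi> x
  proof -
    have "cinner (\<xi> z) h *\<^sub>C e z x = 0" if "z \<in> D" for z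
      using that \<open>x \<notin> _\<close> e0[of x z] by (cases "\<xi> z = 0") (auto simp: scaleC_zero_right cinner.zero_left)
    then show ?thesis unfolding E_def by (simp add: sum.neutral)
  qed
  have norm_E: "(L2_norm \<nu> (E \<xi>))\<^sup>2 \<le> (\<Sum>z\<in>D. (norm (\<xi> z))\<^sup>2)" for \<xi>
  proof -
    have "E \<xi> = cutoff PP (E \<xi>)"
      using E_off[of _ \<xi>] by (auto simp: indicator_def fun_eq_iff PP)
    then have "(L2_norm \<nu> (E \<xi>))\<^sup>2 = (\<Sum>z\<in>D. (L2_norm \<nu> (cutoff (P z) (E \<xi>)))\<^sup>2)"
      using sum_L2_norm_cutoff[OF E_L2[of \<xi>] D(1) P(1,2)] unfolding PP by simp
    also have "\<dots> \<le> (\<Sum>z\<in>D. (norm (\<xi> z))\<^sup>2)"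
    proof (intro sum_mono power_mono)
      fix z assume z: "z \<in> D"
      have "cutoff (P z) (E \<xi>) = (\<lambda>x. cinner (\<xi> z) h *\<^sub>C e z x)"
        using E_on[OF z] e0 by (auto simp: indicator_def fun_eq_iff scaleC_zero_right)
      then have "L2_norm \<nu> (cutoff (P z) (E \<xi>)) = cmod (cinner (\<xi> z) h) * L2_norm \<nu> (e z)"
        by (simp add: L2_norm_scaleC)
      also have "\<dots> \<le> (norm (\<xi> z) * norm h) * 1"
        using e(2)[OF z] by (intro mult_mono cmod_cinner_le) auto
      finally show "L2_norm \<nu> (cutoff (P z) (E \<xi>)) \<le> norm (\<xi> z)" using h by simp
    qed simp
    finally show ?thesis .
  qed
  define b where "b \<xi> y = L2_inner \<nu> (T (E \<xi>)) (g y)" for \<xi> y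
  \<comment> \<open>Bessel's inequality: the \<open>g y\<close> have norm at most 1 and live on
    disjoint sets.\<close>
  have b_le: "(\<Sum>y\<in>D. (cmod (b \<xi> y))\<^sup>2) \<le> (L2_norm \<nu> (T (E \<xi>)))\<^sup>2" for \<xi>
  proof -
    have "(\<Sum>y\<in>D. (cmod (b \<xi> y))\<^sup>2) \<le> (\<Sum>y\<in>D. (L2_norm \<nu> (cutoff (P y) (T (E \<xi>))))\<^sup>2)"
    proof (intro sum_mono power_mono)
      fix y assume y: "y \<in> D"
      have "b \<xi> y = L2_inner \<nu> (cutoff (P y) (T (E \<xi>))) (g y)"
        unfolding b_def L2_inner_def
        using g0 by (intro Bochner_Integration.integral_cong) (auto simp: indicator_def cinner.zero_right)
      also have "cmod \<dots> \<le> L2_norm \<nu> (cutoff (P y) (T (E \<xi>))) * L2_norm \<nu> (g y)"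
        using y P(1) by (intro cmod_L2_inner_le L2_cutoff T_L2 E_L2 g) auto
      also have "\<dots> \<le> L2_norm \<nu> (cutoff (P y) (T (E \<xi>))) * 1"
        using g(2)[OF y] by (intro mult_left_mono) auto
      finally show "cmod (b \<xi> y) \<le> L2_norm \<nu> (cutoff (P y) (T (E \<xi>)))" by simp
    qed simp
    also have "\<dots> = (L2_norm \<nu> (cutoff PP (T (E \<xi>))))\<^sup>2"
      unfolding PP using P by (intro sum_L2_norm_cutoff T_L2 E_L2 D) auto
    also have "\<dots> \<le> (L2_norm \<nu> (T (E \<xi>)))\<^sup>2"
      by (intro power_mono L2_norm_cutoff_le T_L2 E_L2 PP_sets) auto
    finally show ?thesis .
  qed
  define \<mu> where "\<mu> = counting_on Z D"
  note \<mu>_L2 = L2_counting_on[OF D, folded \<mu>_def]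
  note \<mu>_norm = L2_norm_counting_on[OF D, folded \<mu>_def]
  note \<mu>_AE = AE_counting_on[OF D, folded \<mu>_def]
  note \<mu>_Supp = Supp_counting_on[OF D, folded \<mu>_def]
  \<comment> \<open>The matrix \<open>b\<close>, with values placed on the line of h; the value 0
    off D secures measurability on Z.\<close>
  define S where "S \<xi> = (\<lambda>y. if y \<in> D then b \<xi> y *\<^sub>C h else 0)" for \<xi>
  have S_L2: "S \<xi> \<in> L2 \<mu>" for \<xi>
    unfolding \<mu>_L2 unfolding \<mu>_def by (rule borel_measurable_counting_on[OF D]) (simp add: S_def)
  have S_norm: "(L2_norm \<mu> (S \<xi>))\<^sup>2 = (\<Sum>y\<in>D. (cmod (b \<xi> y))\<^sup>2)" for \<xi>
    unfolding \<mu>_norm[OF S_L2] by (rule sum.cong) (simp_all add: S_def norm_scaleC h)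
  have S_le: "L2_norm \<mu> (S \<xi>) \<le> L2_norm \<nu> (T (E \<xi>))" for \<xi>
    using b_le[of \<xi>] unfolding S_norm[symmetric] by (rule power2_le_imp_le) simp
  have E_le: "L2_norm \<nu> (E \<xi>) \<le> L2_norm \<mu> \<xi>" if "\<xi> \<in> L2 \<mu>" for \<xi>
    using norm_E[of \<xi>] unfolding \<mu>_norm[OF that, symmetric] by (rule power2_le_imp_le) simp
  have S_bounded: "bounded_operator \<mu> S"
    unfolding bounded_operator_def
  proof (intro conjI ballI allI impI exI)
    show "S \<xi> \<in> L2 \<mu>" for \<xi> by (rule S_L2)
    show "AE x in \<mu>. S \<xi> x = S \<eta> x" if "AE x in \<mu>. \<xi> x = \<eta> x" for \<xi> \<eta>
    proof -
      have "E \<xi> = E \<eta>" using that unfolding \<mu>_AE by (simp add: E_def)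
      then show ?thesis by (simp add: S_def b_def)
    qed
    show "AE x in \<mu>. S (\<lambda>y. \<xi> y + \<eta> y) x = S \<xi> x + S \<eta> x" for \<xi> \<eta>
      unfolding \<mu>_AE
    proof
      fix y assume y: "y \<in> D"
      have "E (\<lambda>y. \<xi> y + \<eta> y) = (\<lambda>x. E \<xi> x + E \<eta> x)"
        by (simp add: E_def cinner_add_left scaleC_add_left sum.distrib)
      then have "AE x in \<nu>. T (E (\<lambda>y. \<xi> y + \<eta> y)) x = T (E \<xi>) x + T (E \<eta>) x"
        using bounded_operator_add[OF bop E_L2[of \<xi>] E_L2[of \<eta>]] by simp
      then have "b (\<lambda>y. \<xi> y + \<eta> y) y = L2_inner \<nu> (\<lambda>x. T (E \<xi>) x + T (E \<eta>) x) (g y)"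
        unfolding b_def by (intro L2_inner_cong_AE L2_add T_L2 E_L2 g y)
      also have "\<dots> = b \<xi> y + b \<eta> y"
        unfolding b_def by (intro L2_inner_add_left T_L2 E_L2 g y)
      finally show "S (\<lambda>y. \<xi> y + \<eta> y) y = S \<xi> y + S \<eta> y"
        using y by (simp add: S_def scaleC_add_left)
    qed
    show "AE x in \<mu>. S (\<lambda>y. a *\<^sub>C \<xi> y) x = a *\<^sub>C S \<xi> x" for a \<xi>
      unfolding \<mu>_AE
    proof
      fix y assume y: "y \<in> D"
      have "E (\<lambda>y. a *\<^sub>C \<xi> y) = (\<lambda>x. a *\<^sub>C E \<xi> x)"
        by (simp add: E_def cinner_scaleC_left scaleC_scaleC[symmetric]
            linear_sum[OF bounded_linear.linear[OF bounded_linear_scaleC]])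
      then have "AE x in \<nu>. T (E (\<lambda>y. a *\<^sub>C \<xi> y)) x = a *\<^sub>C T (E \<xi>) x"
        using bounded_operator_scaleC[OF bop E_L2[of \<xi>]] by simp
      then have "b (\<lambda>y. a *\<^sub>C \<xi> y) y = L2_inner \<nu> (\<lambda>x. a *\<^sub>C T (E \<xi>) x) (g y)"
        unfolding b_def by (intro L2_inner_cong_AE L2_scaleC T_L2 E_L2 g y)
      also have "\<dots> = a * b \<xi> y"
        unfolding b_def by (rule L2_inner_scaleC_left)
      finally show "S (\<lambda>y. a *\<^sub>C \<xi> y) y = a *\<^sub>C S \<xi> y"
        using y by (simp add: S_def scaleC_scaleC)
    qed
    show "L2_norm \<mu> (S \<xi>) \<le> operator_norm \<nu> T * L2_norm \<mu> \<xi>" if "\<xi> \<in> L2 \<mu>" for \<xi>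
    proof -
      have "L2_norm \<mu> (S \<xi>) \<le> operator_norm \<nu> T * L2_norm \<nu> (E \<xi>)"
        using S_le L2_norm_operator_le[OF bop E_L2] by (rule order_trans)
      also have "\<dots> \<le> operator_norm \<nu> T * L2_norm \<mu> \<xi>"
        by (intro mult_left_mono E_le that operator_norm_nonneg[OF bop])
      finally show ?thesis .
    qed
  qed
  \<comment> \<open>Each piece lies within M of its base point, so base points further apart than
    k+2M+1 have pieces at distance above k+1, where T has no coefficient.\<close>
  have S_prop: "S \<in> propagation_at_most (real (k + 2 * M + 1)) \<mu>"
    unfolding propagation_at_most_def
  proof (intro CollectI conjI ballI impI S_bounded)
    fix \<xi> \<eta> :: "'a \<Rightarrow> 'h"
    assume \<xi>: "\<xi> \<in> L2 \<mu>" and \<eta>: "\<eta> \<in> L2 \<mu>"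
      and far: "ereal (real (k + 2 * M + 1)) < set_distance (Supp \<mu> \<xi>) (Supp \<mu> \<eta>)"
    have "cinner (S \<xi> y) (\<eta> y) = 0" if y: "y \<in> D" for y
    proof (cases "\<eta> y = 0")
      case False
      have "AE x in \<nu>. x \<in> P y \<longrightarrow> T (E \<xi>) x = 0"
      proof (rule propagation_vanish[OF T E_L2 E_off P(1)[OF y], where \<rho> = "real k + 1"])
        fix a u assume "a \<in> (\<Union>z\<in>{z \<in> D. \<xi> z \<noteq> 0}. P z)" and u: "u \<in> P y"
        then obtain z where z: "z \<in> D" "\<xi> z \<noteq> 0" "a \<in> P z" by blast
        have "set_distance (Supp \<mu> \<xi>) (Supp \<mu> \<eta>) \<le> ereal (dist z y)"
          unfolding set_distance_def \<mu>_Supp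
          by (rule INF_lower2[of "(z, y)"]) (use z y False in auto)
        with far have "ereal (real (k + 2 * M + 1)) < ereal (dist z y)" by (rule less_le_trans)
        moreover have "dist z a \<le> real M" "dist y u \<le> real M"
          using P(3)[OF z(1)] P(3)[OF y] z(3) u by auto
        moreover have "dist z y \<le> dist z a + dist a u + dist y u"
          by (metis add.assoc add_left_mono dist_commute dist_triangle order_trans)
        ultimately show "real k + 1 \<le> dist a u" by simp
      qed auto
      then have "AE x in \<nu>. cinner (T (E \<xi>) x) (g y x) = 0"
        by eventually_elim (metis cinner.zero_left cinner.zero_right g0)
      then have "b \<xi> y = 0"
        unfolding b_def L2_inner_def by (rule integral_eq_zero_AE)
      then show ?thesis by (simp add: S_def cinner.zero_left)
    qed (simp add: cinner.zero_right)
    moreover have "L2_inner \<mu> (S \<xi>) \<eta> = (\<Sum>y\<in>D. cinner (S \<xi> y) (\<eta> y))"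
      unfolding L2_inner_def unfolding \<mu>_def
      using L2_measurable[OF S_L2[of \<xi>]] L2_measurable[OF \<eta>]
      by (intro integral_counting_on[OF D] borel_measurable_cinner) (simp_all add: \<mu>_def)
    ultimately show "L2_inner \<mu> (S \<xi>) \<eta> = 0" by simp
  qed
  \<comment> \<open>The coordinates of the cut \<phi>: E maps them back to it almost everywhere,
    with equal norms. They bound the norm of S from below.\<close>
  define a where "a = (\<lambda>z. if z \<in> D then n z *\<^sub>R h else 0)"
  have a: "a \<in> L2 \<mu>"
    unfolding \<mu>_L2 unfolding \<mu>_def by (rule borel_measurable_counting_on[OF D]) (simp add: a_def)
  have a_norm: "L2_norm \<mu> a = L2_norm \<nu> (cutoff PP \<phi>)"
  proof -
    have "(L2_norm \<mu> a)\<^sup>2 = (\<Sum>z\<in>D. (n z)\<^sup>2)"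
      unfolding \<mu>_norm[OF a] by (rule sum.cong) (simp_all add: a_def h)
    also have "\<dots> = (L2_norm \<nu> (cutoff PP \<phi>))\<^sup>2"
      unfolding PP n_def using P by (intro sum_L2_norm_cutoff \<phi> D) auto
    finally show ?thesis by (rule power2_eq_imp_eq) auto
  qed
  \<comment> \<open>Where n z = 0 the vector \<open>e z\<close> is identically zero, whereas the
    piece of \<phi> vanishes only almost everywhere.\<close>
  have "AE x in \<nu>. \<forall>z\<in>D. n z = 0 \<longrightarrow> cutoff (P z) \<phi> x = 0"
  proof (rule AE_finite_allI[OF D(1)])
    fix z assume "z \<in> D"
    then show "AE x in \<nu>. n z = 0 \<longrightarrow> cutoff (P z) \<phi> x = 0"
      using L2_norm_eq_0_iff[OF L2_cutoff[OF \<phi> P(1)]] by (cases "n z = 0") (auto simp: n_def)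
  qed
  then have "AE x in \<nu>. E a x = cutoff PP \<phi> x"
  proof eventually_elim
    fix x assume x: "\<forall>z\<in>D. n z = 0 \<longrightarrow> cutoff (P z) \<phi> x = 0"
    show "E a x = cutoff PP \<phi> x"
    proof (cases "x \<in> PP")
      case True
      then obtain z where z: "z \<in> D" "x \<in> P z" by (auto simp: PP)
      have "cinner (a z) h = complex_of_real (n z)"
        using z h by (simp add: a_def cinner_scaleR_left cinner_self)
      then have "E a x = complex_of_real (n z * (1 / n z)) *\<^sub>C cutoff (P z) \<phi> x"
        unfolding E_on[OF z] by (simp add: e_def scaleC_scaleC)
      also have "\<dots> = \<phi> x"
        using x z by (cases "n z = 0") (auto simp: scaleC_of_real[of 1, simplified])
      finally show ?thesis using True by simp
    next
      case False
      then show ?thesis using E_off[of x a] by (auto simp: PP)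
    qed
  qed
  then have "AE x in \<nu>. T (E a) x = \<psi> x"
    unfolding \<psi>_def using \<phi> PP_sets by (intro bounded_operator_cong[OF bop] E_L2) auto
  then have "b a y = complex_of_real (n' y)" if "y \<in> D" for y
  proof -
    have "b a y = L2_inner \<nu> \<psi> (g y)"
      unfolding b_def using \<open>AE x in \<nu>. T (E a) x = \<psi> x\<close> that by (intro L2_inner_cong_AE T_L2 E_L2 \<psi> g)
    also have "\<dots> = complex_of_real (1 / n' y * (n' y)\<^sup>2)"
      unfolding g_def n'_def by (rule L2_inner_cutoff_self)
    also have "\<dots> = complex_of_real (n' y)" by (simp add: power2_eq_square)
    finally show ?thesis .
  qed
  \<comment> \<open>The rows were built from the image of \<phi>, so Bessel's inequality loses
    nothing beyond the cut to PP.\<close>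
  then have "(L2_norm \<mu> (S a))\<^sup>2 = (\<Sum>y\<in>D. (n' y)\<^sup>2)"
    unfolding S_norm by (intro sum.cong) simp_all
  also have "\<dots> = (L2_norm \<nu> (cutoff PP \<psi>))\<^sup>2"
    unfolding PP n'_def using P by (intro sum_L2_norm_cutoff \<psi> D) auto
  finally have "L2_norm \<mu> (S a) = L2_norm \<nu> (cutoff PP \<psi>)"
    by (rule power2_eq_imp_eq) auto
  then have S_ge: "L2_norm \<nu> (cutoff PP \<psi>) \<le> operator_norm \<mu> S * L2_norm \<nu> (cutoff PP \<phi>)"
    using L2_norm_operator_le[OF S_bounded a] a_norm by simp
  have pos': "0 < L2_norm \<nu> (cutoff PP \<psi>)" using pos by (simp add: \<psi>_def)
  then have S_pos: "0 < operator_norm \<mu> S"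
    using S_ge operator_norm_nonneg[OF S_bounded] by (cases "operator_norm \<mu> S = 0") auto
  \<comment> \<open>Positivity of the measure requires a point of mass.\<close>
  have "D \<noteq> {}"
  proof
    assume "D = {}"
    then have "L2_norm \<nu> (cutoff PP \<psi>) = 0" by (simp add: PP L2_norm_def)
    then show False using pos' by simp
  qed
  then have "positive_locally_finite_borel Z \<mu>"
    unfolding \<mu>_def by (rule positive_locally_finite_counting_on[OF D])
  then obtain \<xi> :: "'a \<Rightarrow> 'h" where \<xi>: "\<xi> \<in> L2 \<mu>" "\<not> (AE x in \<mu>. \<xi> x = 0)" "bounded (Supp \<mu> \<xi>)"
    "diameter (Supp \<mu> \<xi>) \<le> real (f (k + 2 * M + 1))"
    "c * operator_norm \<mu> S * L2_norm \<mu> \<xi> \<le> L2_norm \<mu> (S \<xi>)"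
    using onl S_prop unfolding onl_with_def by blast
  have "0 < L2_norm \<mu> \<xi>"
    using \<xi>(2) L2_norm_eq_0_iff[OF \<xi>(1)] by (simp add: less_le)
  \<comment> \<open>E forgets everything orthogonal to h, so E \<xi> could be null although \<xi> is
    not. A positive norm of S \<xi>, which \<open>T (E \<xi>)\<close> dominates, rules this
    out.\<close>
  then have "0 < L2_norm \<mu> (S \<xi>)"
    using \<xi>(5) S_pos \<open>0 < c\<close> by (intro less_le_trans[OF _ \<xi>(5)] mult_pos_pos)
  then have TE_pos: "0 < L2_norm \<nu> (T (E \<xi>))"
    using S_le by (rule less_le_trans)
  let ?A = "\<Union>z\<in>{z \<in> D. \<xi> z \<noteq> 0}. P z"
  have A_dist: "dist x y \<le> real (f (k + 2 * M + 1)) + 2 * real M" if "x \<in> ?A" "y \<in> ?A" for x y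
  proof -
    obtain z z' where z: "z \<in> D" "\<xi> z \<noteq> 0" "x \<in> P z" and z': "z' \<in> D" "\<xi> z' \<noteq> 0" "y \<in> P z'"
      using \<open>x \<in> ?A\<close> \<open>y \<in> ?A\<close> by blast
    have "dist z z' \<le> diameter (Supp \<mu> \<xi>)"
      using z z' by (intro diameter_bounded_bound \<xi>(3)) (auto simp: \<mu>_Supp)
    moreover have "dist z x \<le> real M" "dist z' y \<le> real M"
      using P(3)[OF z(1)] P(3)[OF z'(1)] z(3) z'(3) by auto
    moreover have "dist x y \<le> dist z x + dist z z' + dist z' y"
      by (metis add.assoc add_left_mono dist_commute dist_triangle order_trans)
    ultimately show ?thesis using \<xi>(4) by linarith
  qed
  have Supp: "Supp \<nu> (E \<xi>) \<subseteq> closure ?A"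
    by (rule Supp_subset_closure) (rule E_off)
  show ?thesis
  proof (rule that[of "E \<xi>"])
    show "E \<xi> \<in> L2 \<nu>" by (rule E_L2)
    show "\<not> (AE x in \<nu>. E \<xi> x = 0)"
      using L2_norm_eq_0_iff[OF E_L2[of \<xi>]] L2_norm_operator_le[OF bop E_L2[of \<xi>]] TE_pos by auto
    show "bounded (Supp \<nu> (E \<xi>))"
      and "diameter (Supp \<nu> (E \<xi>)) \<le> real (f (k + 2 * M + 1)) + 2 * real M"
      by (rule bounded_diameter_closure[OF _ _ Supp], erule (1) A_dist, simp)+
    have "c * L2_norm \<nu> (cutoff PP \<psi>) * L2_norm \<nu> (E \<xi>)
        \<le> c * (operator_norm \<mu> S * L2_norm \<nu> (cutoff PP \<phi>)) * L2_norm \<mu> \<xi>"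
      using S_ge E_le[OF \<xi>(1)] \<open>0 < c\<close> S_pos by (intro mult_mono) auto
    also have "\<dots> = (c * operator_norm \<mu> S * L2_norm \<mu> \<xi>) * L2_norm \<nu> (cutoff PP \<phi>)"
      by (simp add: ac_simps)
    also have "\<dots> \<le> L2_norm \<nu> (T (E \<xi>)) * L2_norm \<nu> (cutoff PP \<phi>)"
      using \<xi>(5) S_le[of \<xi>] by (intro mult_right_mono) auto
    finally show "c * L2_norm \<nu> (cutoff PP (T (cutoff PP \<phi>))) * L2_norm \<nu> (E \<xi>)
        \<le> L2_norm \<nu> (T (E \<xi>)) * L2_norm \<nu> (cutoff PP \<phi>)"
      by (simp only: \<psi>_def)
  qed
qed

text \<open>Balls are added one at a time, each contributing only what the earlier ones missed. If
  that remainder N is nonempty, one of its points has a point of Z within m; a unit ball has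
  diameter at most 2, so all of N is within m+2 of that point.\<close>

lemma finite_partition_of_balls:
  fixes \<nu> :: "'a::metric_space measure"
  assumes \<nu>: "sets \<nu> = sets (restrict_space borel X)" and "finite F" and W: "W \<in> sets \<nu>"
    and near: "\<forall>w\<in>W. \<exists>z\<in>Z. dist w z \<le> m"
  shows "\<exists>D P. finite D \<and> D \<subseteq> Z \<and> (\<forall>y\<in>D. P y \<in> sets \<nu> \<and> P y \<subseteq> cball y (m + 2)) \<and>
    disjoint_family_on P D \<and> (\<Union>y\<in>D. P y) = unit_balls \<nu> F \<inter> W"
  using assms(2)
proof (induction F)
  case empty
  show ?case by (rule exI[of _ "{}"]) (auto simp: disjoint_family_on_def)
next
  case (insert x F)
  obtain D P where DP: "finite D \<and> D \<subseteq> Z \<and> (\<forall>y\<in>D. P y \<in> sets \<nu> \<and> P y \<subseteq> cball y (m + 2)) \<and>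
    disjoint_family_on P D \<and> (\<Union>y\<in>D. P y) = unit_balls \<nu> F \<inter> W"
    using insert.IH by (elim exE) (rule that)
  then have D: "finite D" "D \<subseteq> Z" "\<And>y. y \<in> D \<Longrightarrow> P y \<in> sets \<nu>"
    "\<And>y. y \<in> D \<Longrightarrow> P y \<subseteq> cball y (m + 2)" "disjoint_family_on P D"
    "(\<Union>y\<in>D. P y) = unit_balls \<nu> F \<inter> W"
    by simp_all
  define N where "N = (space \<nu> \<inter> cball x 1) \<inter> W - unit_balls \<nu> F"
  have N: "N \<in> sets \<nu>"
    unfolding N_def using W insert.hyps
    by (intro sets.Diff sets.Int[OF _ W] space_Int_closed_sets[OF \<nu>]) auto
  have UN: "unit_balls \<nu> (insert x F) \<inter> W = unit_balls \<nu> F \<inter> W \<union> N"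
    unfolding N_def by blast
  show ?case
  proof (cases "N = {}")
    case True
    then have "unit_balls \<nu> (insert x F) \<inter> W = unit_balls \<nu> F \<inter> W" using UN by blast
    then show ?thesis using insert.IH by simp
  next
    case False
    then obtain w where w: "w \<in> N" by blast
    then obtain z where z: "z \<in> Z" "dist w z \<le> m" using near by (auto simp: N_def)
    have Nz: "N \<subseteq> cball z (m + 2)"
    proof
      fix u assume "u \<in> N"
      then have "dist x u \<le> 1" "dist x w \<le> 1" using w by (auto simp: N_def)
      moreover have "dist z u \<le> dist w z + dist x w + dist x u"
        by (metis add.assoc add_left_mono dist_commute dist_triangle order_trans)
      ultimately show "u \<in> cball z (m + 2)" using z(2) by simp
    qed
    \<comment> \<open>The chosen z may already be a base point; then N is merged into its
      piece.\<close>
    define P' where "P' y = (if y \<in> D then P y else {}) \<union> (if y = z then N else {})" for y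
    have disj: "N \<inter> P y = {}" if "y \<in> D" for y
      using D(6) that unfolding N_def by blast
    have "disjoint_family_on P' (insert z D)"
      using D(5) disj unfolding disjoint_family_on_def P'_def by auto
    moreover have "(\<Union>y\<in>insert z D. P' y) = (\<Union>y\<in>D. P y) \<union> N"
      unfolding P'_def by (auto split: if_splits)
    moreover have "P' y \<in> sets \<nu> \<and> P' y \<subseteq> cball y (m + 2)" if "y \<in> insert z D" for y
    proof
      show "P' y \<in> sets \<nu>" unfolding P'_def using D(3) N by auto
      show "P' y \<subseteq> cball y (m + 2)"
        unfolding P'_def using D(4)[of y] Nz by (auto simp del: mem_cball)
    qed
    ultimately show ?thesis
      using D(1,2,6) z(1) unfolding UN by (intro exI[of _ "insert z D"] exI[of _ P']) auto
  qed
qed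

text \<open>The image of \<phi> lives within m+k+1 of Z. Choosing actual points of Z costs 1 more,
  and the balls cost 2, which gives M. The approximation losses are absorbed by the strict
  inequality for a, so only the factor c remains.\<close>

lemma localization_near:
  fixes \<nu> :: "'a::metric_space measure" and k m M :: nat and f :: "nat \<Rightarrow> nat"
    and T :: "('a \<Rightarrow> 'h::{complex_hilbert,second_countable_topology}) \<Rightarrow> ('a \<Rightarrow> 'h)" and h :: 'h
  assumes \<nu>: "sets \<nu> = sets (restrict_space borel X)"
    and T: "T \<in> propagation_at_most (real k) \<nu>"
    and onl: "onl_with TYPE('h) Z c f" and "0 < c" and "Z \<noteq> {}" and h: "norm h = 1"
    and \<phi>: "\<phi> \<in> L2 \<nu>" and off: "\<And>x. x \<in> space \<nu> \<Longrightarrow> real m < infdist x Z \<Longrightarrow> \<phi> x = 0"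
    and a: "0 \<le> a" "a * L2_norm \<nu> \<phi> < L2_norm \<nu> (T \<phi>)"
    and M: "M = m + k + 4"
  obtains \<theta> where "\<theta> \<in> L2 \<nu>" "\<not> (AE x in \<nu>. \<theta> x = 0)" "bounded (Supp \<nu> \<theta>)"
    "diameter (Supp \<nu> \<theta>) \<le> real (f (k + 2 * M + 1) + 2 * M)"
    "c * a * L2_norm \<nu> \<theta> \<le> L2_norm \<nu> (T \<theta>)"
proof -
  note bop = T_bounded[OF T]
  note T_L2 = bounded_operator_L2[OF bop]
  \<comment> \<open>A third of the slack: one \<delta> is lost on \<phi>, one on its image, and the
    third keeps the inequality strict.\<close>
  define \<delta> where "\<delta> = (L2_norm \<nu> (T \<phi>) - a * L2_norm \<nu> \<phi>) / 3"
  have "0 < \<delta>" using a(2) by (simp add: \<delta>_def)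
  obtain F1 where F1: "finite F1"
    "\<And>Q. Q \<in> sets \<nu> \<Longrightarrow> unit_balls \<nu> F1 \<subseteq> Q \<Longrightarrow> L2_norm \<nu> (T (cutoff (space \<nu> - Q) \<phi>)) \<le> \<delta>"
    by (rule operator_exhaustion[OF \<nu> T \<phi> \<open>0 < \<delta>\<close>]) blast
  obtain F2 where F2: "finite F2"
    "\<And>Q. Q \<in> sets \<nu> \<Longrightarrow> unit_balls \<nu> F2 \<subseteq> Q \<Longrightarrow> L2_norm \<nu> (cutoff (space \<nu> - Q) (T \<phi>)) \<le> \<delta>"
    by (rule image_exhaustion[OF \<nu> T \<phi> \<open>0 < \<delta>\<close>]) blast
  define Q where "Q = unit_balls \<nu> (F1 \<union> F2)"
  have Q: "Q \<in> sets \<nu>"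
    unfolding Q_def using F1 F2 by (intro space_Int_closed_sets[OF \<nu>]) auto
  have Q1: "L2_norm \<nu> (T (cutoff (space \<nu> - Q) \<phi>)) \<le> \<delta>"
    by (rule F1(2)[OF Q]) (auto simp: Q_def)
  have Q2: "L2_norm \<nu> (cutoff (space \<nu> - Q) (T \<phi>)) \<le> \<delta>"
    by (rule F2(2)[OF Q]) (auto simp: Q_def)
  \<comment> \<open>The radius exceeds m by k+1, so \<phi> and its image both vanish outside
    W.\<close>
  define W where "W = {x \<in> space \<nu>. infdist x Z \<le> real (m + k + 1)}"
  have W: "W \<in> sets \<nu>"
    unfolding W_def using infdist_borel_measurable[OF \<nu>, of Z] by measurable
  have near: "\<forall>w\<in>W. \<exists>z\<in>Z. dist w z \<le> real (m + k + 2)"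
  proof
    fix w assume "w \<in> W"
    then have "infdist w Z < real (m + k + 2)" by (simp add: W_def)
    then show "\<exists>z\<in>Z. dist w z \<le> real (m + k + 2)"
      by (rule infdist_lessE[OF \<open>Z \<noteq> {}\<close>]) (auto intro: less_imp_le)
  qed
  obtain D P where DP: "finite D \<and> D \<subseteq> Z \<and>
    (\<forall>y\<in>D. P y \<in> sets \<nu> \<and> P y \<subseteq> cball y (real (m + k + 2) + 2)) \<and>
    disjoint_family_on P D \<and> (\<Union>y\<in>D. P y) = Q \<inter> W"
    using finite_partition_of_balls[OF \<nu> finite_UnI[OF F1(1) F2(1)] W near, folded Q_def]
    by (elim exE) (rule that)
  then have D: "finite D" "D \<subseteq> Z" "\<And>y. y \<in> D \<Longrightarrow> P y \<in> sets \<nu>"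
    "\<And>y. y \<in> D \<Longrightarrow> P y \<subseteq> cball y (real (m + k + 2) + 2)" "disjoint_family_on P D"
    "(\<Union>y\<in>D. P y) = Q \<inter> W"
    by simp_all
  define PP where "PP = (\<Union>y\<in>D. P y)"
  have PP: "PP = Q \<inter> W" "PP \<in> sets \<nu>" using D(6) Q W by (auto simp: PP_def)
  have PM: "P y \<subseteq> cball y (real M)" if "y \<in> D" for y
    using D(4)[OF that] by (simp add: M algebra_simps)
  let ?\<phi>1 = "cutoff PP \<phi>" and ?\<phi>2 = "cutoff (space \<nu> - Q) \<phi>"
  have \<phi>12: "?\<phi>1 \<in> L2 \<nu>" "?\<phi>2 \<in> L2 \<nu>" using \<phi> PP(2) Q by auto
  \<comment> \<open>The missing region, Q outside W, carries nothing of \<phi>.\<close>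
  have "\<phi> x = ?\<phi>1 x + ?\<phi>2 x" if "x \<in> space \<nu>" for x
    using that off[OF that] by (auto simp: PP(1) W_def indicator_def not_le)
  then have split: "AE x in \<nu>. T \<phi> x = T ?\<phi>1 x + T ?\<phi>2 x"
    by (intro L2_norm_operator_triangle(2)[OF bop] \<phi>12 \<phi>)
  have "AE x in \<nu>. x \<in> space \<nu> - W \<longrightarrow> T \<phi> x = 0"
  proof (rule propagation_vanish[OF T \<phi>, where A = "{x. infdist x Z \<le> real m}" and \<rho> = "real k + 1"])
    fix y u assume "y \<in> {x. infdist x Z \<le> real m}" "u \<in> space \<nu> - W"
    then show "real k + 1 \<le> dist y u"
      using infdist_triangle[of u Z y] by (auto simp: W_def dist_commute)
  qed (use off W in \<open>auto simp: not_le\<close>)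
  then have "AE x in \<nu>. T \<phi> x = cutoff PP (T \<phi>) x + cutoff (space \<nu> - Q) (T \<phi>) x"
    using AE_space by eventually_elim (auto simp: PP(1) indicator_def)
  then have "L2_norm \<nu> (T \<phi>) = L2_norm \<nu> (\<lambda>x. cutoff PP (T \<phi>) x + cutoff (space \<nu> - Q) (T \<phi>) x)"
    by (intro L2_norm_cong_AE L2_measurable[OF T_L2] L2_measurable[OF L2_add] L2_cutoff T_L2 \<phi> PP sets.Diff sets.top Q)
  also have "\<dots> \<le> L2_norm \<nu> (cutoff PP (T \<phi>)) + L2_norm \<nu> (cutoff (space \<nu> - Q) (T \<phi>))"
    by (intro L2_norm_triangle L2_cutoff T_L2 \<phi> PP sets.Diff sets.top Q)
  finally have le1: "L2_norm \<nu> (T \<phi>) \<le> L2_norm \<nu> (cutoff PP (T \<phi>)) + \<delta>"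
    using Q2 by linarith
  have "AE x in \<nu>. cutoff PP (T \<phi>) x = cutoff PP (T ?\<phi>1) x + cutoff PP (T ?\<phi>2) x"
    using split by eventually_elim (simp add: scaleR_add_right)
  then have "L2_norm \<nu> (cutoff PP (T \<phi>)) = L2_norm \<nu> (\<lambda>x. cutoff PP (T ?\<phi>1) x + cutoff PP (T ?\<phi>2) x)"
    by (intro L2_norm_cong_AE L2_measurable[OF L2_cutoff] L2_measurable[OF L2_add] L2_cutoff T_L2 \<phi> \<phi>12 PP)
  also have "\<dots> \<le> L2_norm \<nu> (cutoff PP (T ?\<phi>1)) + L2_norm \<nu> (cutoff PP (T ?\<phi>2))"
    by (intro L2_norm_triangle L2_cutoff T_L2 \<phi>12 PP)
  also have "L2_norm \<nu> (cutoff PP (T ?\<phi>2)) \<le> \<delta>"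
    using L2_norm_cutoff_le[OF T_L2[OF \<phi>12(2)] PP(2)] Q1 by linarith
  finally have le2: "L2_norm \<nu> (cutoff PP (T \<phi>)) \<le> L2_norm \<nu> (cutoff PP (T ?\<phi>1)) + \<delta>"
    by simp
  have "a * L2_norm \<nu> ?\<phi>1 \<le> a * L2_norm \<nu> \<phi>"
    by (intro mult_left_mono L2_norm_cutoff_le \<phi> PP a)
  then have big: "a * L2_norm \<nu> ?\<phi>1 < L2_norm \<nu> (cutoff PP (T ?\<phi>1))"
    using le1 le2 \<open>0 < \<delta>\<close> by (simp add: \<delta>_def field_simps)
  then have pos: "0 < L2_norm \<nu> (cutoff PP (T ?\<phi>1))"
    using a(1) by (intro le_less_trans[OF _ big] mult_nonneg_nonneg) auto
  have "L2_norm \<nu> (cutoff PP (T ?\<phi>1)) \<le> operator_norm \<nu> T * L2_norm \<nu> ?\<phi>1"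
    using L2_norm_cutoff_le[OF T_L2[OF \<phi>12(1)] PP(2)] L2_norm_operator_le[OF bop \<phi>12(1)] by linarith
  then have pos1: "0 < L2_norm \<nu> ?\<phi>1"
    using pos by (cases "L2_norm \<nu> ?\<phi>1 = 0") (auto simp: less_le)
  obtain \<theta> where \<theta>: "\<theta> \<in> L2 \<nu>" "\<not> (AE x in \<nu>. \<theta> x = 0)" "bounded (Supp \<nu> \<theta>)"
    "diameter (Supp \<nu> \<theta>) \<le> real (f (k + 2 * M + 1)) + 2 * real M"
    "c * L2_norm \<nu> (cutoff PP (T ?\<phi>1)) * L2_norm \<nu> \<theta> \<le> L2_norm \<nu> (T \<theta>) * L2_norm \<nu> ?\<phi>1"
    by (rule localization_transfer[OF T onl \<open>0 < c\<close> D(1,2) _ D(5) _ \<phi> h PP_def pos],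
        erule D(3), erule PM, blast)
  have "c * (a * L2_norm \<nu> ?\<phi>1) * L2_norm \<nu> \<theta> \<le> c * L2_norm \<nu> (cutoff PP (T ?\<phi>1)) * L2_norm \<nu> \<theta>"
    using big \<open>0 < c\<close> by (intro mult_right_mono mult_left_mono) auto
  then have "(c * a * L2_norm \<nu> \<theta>) * L2_norm \<nu> ?\<phi>1 \<le> L2_norm \<nu> (T \<theta>) * L2_norm \<nu> ?\<phi>1"
    using \<theta>(5) by (simp add: ac_simps)
  then have "c * a * L2_norm \<nu> \<theta> \<le> L2_norm \<nu> (T \<theta>)"
    using pos1 by (simp add: mult_le_cancel_right)
  with \<theta> that show ?thesis by simp
qed

section \<open>Nonzero vectors of small support\<close>

lemma L2_cutoff_const:
  fixes h :: "'h::{complex_hilbert,second_countable_topology}"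
  assumes "B \<in> sets \<nu>" "emeasure \<nu> B < \<infinity>" "emeasure \<nu> B \<noteq> 0" "h \<noteq> 0"
  shows "cutoff B (\<lambda>_. h) \<in> L2 \<nu>" "\<not> (AE x in \<nu>. cutoff B (\<lambda>_. h) x = 0)"
proof -
  have [measurable]: "B \<in> sets \<nu>" by fact
  have "(norm (cutoff B (\<lambda>_. h) x))\<^sup>2 = indicator B x * (norm h)\<^sup>2" for x
    by (auto simp: indicator_def)
  moreover have "integrable \<nu> (\<lambda>x. indicator B x * (norm h)\<^sup>2)"
    using integrable_real_indicator[OF assms(1,2)] by simp
  ultimately show "cutoff B (\<lambda>_. h) \<in> L2 \<nu>" by (simp add: L2_iff)
  show "\<not> (AE x in \<nu>. cutoff B (\<lambda>_. h) x = 0)"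
  proof
    assume "AE x in \<nu>. cutoff B (\<lambda>_. h) x = 0"
    then have "AE x in \<nu>. x \<notin> B" using assms(4) by (simp add: indicator_def)
    then show False
      using assms(1,3) AE_iff_null_sets[of B \<nu>] by auto
  qed
qed

text \<open>Serves operators of norm 0, for which any nonzero vector of controlled support will do.
  A unit ball of positive measure carries one; if there is none, a larger ball carries one whose
  support is empty.\<close>

lemma exists_small_support:
  fixes \<nu> :: "'a::metric_space measure" and h :: "'h::{complex_hilbert,second_countable_topology}"
  assumes \<nu>: "positive_locally_finite_borel X \<nu>" and h: "h \<noteq> 0"
  obtains \<theta> :: "'a \<Rightarrow> 'h" where "\<theta> \<in> L2 \<nu>" "\<not> (AE x in \<nu>. \<theta> x = 0)"
    "bounded (Supp \<nu> \<theta>)" "diameter (Supp \<nu> \<theta>) \<le> 2"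
proof -
  have sets: "sets \<nu> = sets (restrict_space borel X)"
    using \<nu> by (simp add: positive_locally_finite_borel_def)
  let ?B = "\<lambda>x r. space \<nu> \<inter> cball x r"
  have B: "?B x r \<in> sets \<nu>" "emeasure \<nu> (?B x r) < \<infinity>" for x r
  proof -
    show "?B x r \<in> sets \<nu>" by (rule space_Int_closed_sets[OF sets]) simp
    moreover have "bounded (?B x r)" by (rule bounded_subset[OF bounded_cball[of x r]]) auto
    ultimately show "emeasure \<nu> (?B x r) < \<infinity>"
      using \<nu> by (simp add: positive_locally_finite_borel_def)
  qed
  show ?thesis
  proof (cases "\<exists>x. emeasure \<nu> (?B x 1) \<noteq> 0")
    case True
    then obtain x where x: "emeasure \<nu> (?B x 1) \<noteq> 0" by blast
    let ?\<theta> = "cutoff (?B x 1) (\<lambda>_. h)"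
    have Supp: "Supp \<nu> ?\<theta> \<subseteq> closure (cball x 1)"
      by (rule Supp_subset_closure) auto
    have dist: "dist y z \<le> 2" if "y \<in> cball x 1" "z \<in> cball x 1" for y z
      using that dist_triangle2[of y z x] by (simp add: dist_commute)
    show ?thesis
    proof (rule that[of ?\<theta>])
      show "bounded (Supp \<nu> ?\<theta>)" "diameter (Supp \<nu> ?\<theta>) \<le> 2"
        by (rule bounded_diameter_closure[OF _ _ Supp], erule (1) dist, simp)+
    qed (use L2_cutoff_const[OF B x h] in auto)
  next
    case False
    have "space \<nu> \<noteq> {}"
      using \<nu> by (auto simp: positive_locally_finite_borel_def)
    then obtain x where "x \<in> space \<nu>" by blast
    have "(\<Union>n. ?B x (real n)) = space \<nu>"
      using real_arch_simple by auto
    then have pos: "emeasure \<nu> (\<Union>n. ?B x (real n)) \<noteq> 0"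
      using \<nu> by (simp add: positive_locally_finite_borel_def)
    \<comment> \<open>Countably many concentric balls exhaust the space, so they cannot all be
      null.\<close>
    have "\<exists>n. emeasure \<nu> (?B x (real n)) \<noteq> 0"
    proof (rule ccontr)
      assume "\<not> ?thesis"
      then have "emeasure \<nu> (\<Union>n. ?B x (real n)) = 0"
        by (intro emeasure_UN_eq_0 image_subsetI B) auto
      then show False using pos by simp
    qed
    then obtain n where n: "emeasure \<nu> (?B x (real n)) \<noteq> 0" by blast
    let ?\<theta> = "cutoff (?B x (real n)) (\<lambda>_. h)"
    have "Supp \<nu> ?\<theta> = {}"
    proof (rule Supp_empty)
      fix y
      have "?B y 1 \<in> null_sets \<nu>" using False B by (auto simp: null_sets_def)
      then have "AE z in \<nu>. z \<notin> ?B y 1" by (rule AE_not_in)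
      then show "AE z in \<nu>. z \<in> ball y 1 \<longrightarrow> ?\<theta> z = 0"
        using AE_space by eventually_elim auto
    qed
    then show ?thesis
      using L2_cutoff_const[OF B n h] by (intro that[of ?\<theta>]) (simp_all add: diameter_def)
  qed
qed

section \<open>The union theorem\<close>

lemma r_disjoint_dist:
  assumes "r_disjoint r I B" "i \<in> I" "j \<in> I" "i \<noteq> j" "a \<in> B i" "b \<in> B j"
  shows "r \<le> dist a b"
proof -
  have "ereal r \<le> set_distance (B i) (B j)"
    using assms by (simp add: r_disjoint_def)
  also have "\<dots> \<le> ereal (dist a b)"
    unfolding set_distance_def by (rule INF_lower2[of "(a, b)"]) (use assms in auto)
  finally show ?thesis by simp
qed

lemma finite_if_at_most_one:
  assumes "\<And>x y. x \<in> S \<Longrightarrow> y \<in> S \<Longrightarrow> x = y"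
  shows "finite S"
proof (cases "S = {}")
  case False
  then obtain x where "x \<in> S" by blast
  then have "S \<subseteq> {x}" using assms by blast
  then show ?thesis by (rule finite_subset) simp
qed simp

text \<open>If every slice exceeded the average 1/N of the total mass, the disjoint slices together
  would carry more than \<phi> does.\<close>

lemma slice_small:
  assumes \<phi>: "\<phi> \<in> L2 \<nu>" and "0 < N" and S: "\<And>j. j < N \<Longrightarrow> S j \<in> sets \<nu>" "disjoint_family_on S {..<N}"
  obtains j where "j < (N::nat)" "(L2_norm \<nu> (cutoff (S j) \<phi>))\<^sup>2 \<le> (L2_norm \<nu> \<phi>)\<^sup>2 / real N"
proof -
  have "(\<Sum>j<N. (L2_norm \<nu> (cutoff (S j) \<phi>))\<^sup>2) = (L2_norm \<nu> (cutoff (\<Union>j<N. S j) \<phi>))\<^sup>2"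
    using S by (intro sum_L2_norm_cutoff \<phi>) auto
  also have "\<dots> \<le> (L2_norm \<nu> \<phi>)\<^sup>2"
    using S(1) by (intro power_mono L2_norm_cutoff_le \<phi>) auto
  finally have le: "(\<Sum>j<N. (L2_norm \<nu> (cutoff (S j) \<phi>))\<^sup>2) \<le> (L2_norm \<nu> \<phi>)\<^sup>2" .
  have "\<exists>j<N. (L2_norm \<nu> (cutoff (S j) \<phi>))\<^sup>2 \<le> (L2_norm \<nu> \<phi>)\<^sup>2 / real N"
  proof (rule ccontr)
    assume "\<not> ?thesis"
    then have "(\<Sum>j<N. (L2_norm \<nu> \<phi>)\<^sup>2 / real N) < (\<Sum>j<N. (L2_norm \<nu> (cutoff (S j) \<phi>))\<^sup>2)"
      using \<open>0 < N\<close> by (intro sum_strict_mono) (auto simp: not_le)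
    then show False using le \<open>0 < N\<close> by simp
  qed
  then show ?thesis using that by blast
qed

text \<open>The diameter bound adds up those of the three cases (\<open>Y\<close>, some
  \<open>A i\<close>, T of norm 0), so it depends on neither \<nu> nor T. The part near Y lies
  within N(2k+3) of it, which gives M; a part beyond the shell lies inside its \<open>A i\<close>,
  at distance 0, which gives \<open>M'\<close>.\<close>

lemma union_localization_step:
  fixes X Y :: "'a::metric_space set" and A :: "'i \<Rightarrow> 'a set" and \<nu> :: "'a measure" and k N :: nat
    and T :: "('a \<Rightarrow> 'h::{complex_hilbert,second_countable_topology}) \<Rightarrow> ('a \<Rightarrow> 'h)" and h :: 'h
  assumes X: "X = (\<Union>i\<in>I. A i)" and A: "\<And>i. i \<in> I \<Longrightarrow> A i \<in> sets (restrict_space borel X)"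
    and fA: "\<And>i. i \<in> I \<Longrightarrow> onl_with TYPE('h) (A i) c fA"
    and Y: "Y \<in> sets (restrict_space borel X)" "onl_with TYPE('h) Y c fY"
    and disj: "r_disjoint (2 * real k + 3) I (\<lambda>i. A i - Y)"
    and c: "0 < c" "c \<le> 1" and \<epsilon>: "0 < \<epsilon>" "\<epsilon> < c" and N: "4 / \<epsilon>\<^sup>2 < real N" and h: "norm h = 1"
    and M: "M = N * (2 * k + 3) + k + 4" "M' = k + 4"
    and \<nu>: "positive_locally_finite_borel X \<nu>" and T: "T \<in> propagation_at_most (real k) \<nu>"
  obtains \<theta> where "\<theta> \<in> L2 \<nu>" "\<not> (AE x in \<nu>. \<theta> x = 0)" "bounded (Supp \<nu> \<theta>)"
    "diameter (Supp \<nu> \<theta>) \<le> real (fY (k + 2 * M + 1) + 2 * M + (fA (k + 2 * M' + 1) + 2 * M') + 2)"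
    "(c - \<epsilon>) * operator_norm \<nu> T * L2_norm \<nu> \<theta> \<le> L2_norm \<nu> (T \<theta>)"
proof -
  note bop = T_bounded[OF T]
  note T_L2 = bounded_operator_L2[OF bop]
  have sets: "sets \<nu> = sets (restrict_space borel X)"
    using \<nu> by (simp add: positive_locally_finite_borel_def)
  have space: "space \<nu> = X"
    using sets_eq_imp_space_eq[OF sets] by (simp add: space_restrict_space)
  note infdist_meas = infdist_borel_measurable[OF sets]
  define t where "t = operator_norm \<nu> T"
  have t_le: "L2_norm \<nu> (T \<phi>) \<le> t * L2_norm \<nu> \<phi>" if "\<phi> \<in> L2 \<nu>" for \<phi>
    unfolding t_def by (rule L2_norm_operator_le[OF bop that])
  have "0 \<le> t" unfolding t_def by (rule operator_norm_nonneg[OF bop])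
  have "0 \<le> 1 - \<epsilon>" using c \<epsilon> by simp
  define s where "s = (1 - \<epsilon>) * t"
  have "0 \<le> s" unfolding s_def using \<open>0 \<le> t\<close> \<open>0 \<le> 1 - \<epsilon>\<close> by simp
  have "(c - \<epsilon>) * t \<le> c * s"
  proof -
    have "c - \<epsilon> \<le> c * (1 - \<epsilon>)"
      using mult_right_mono[OF c(2), of \<epsilon>] \<epsilon> by (simp add: algebra_simps)
    then have "(c - \<epsilon>) * t \<le> c * (1 - \<epsilon>) * t" using \<open>0 \<le> t\<close> by (rule mult_right_mono)
    then show ?thesis by (simp add: s_def ac_simps)
  qed
  then have final: "(c - \<epsilon>) * operator_norm \<nu> T * L2_norm \<nu> \<theta> \<le> L2_norm \<nu> (T \<theta>)"
    if "c * s * L2_norm \<nu> \<theta> \<le> L2_norm \<nu> (T \<theta>)" for \<theta>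
    using mult_right_mono[of "(c - \<epsilon>) * t" "c * s" "L2_norm \<nu> \<theta>"] that
    by (simp add: t_def)
  show ?thesis
  \<comment> \<open>If t = 0, no vector satisfies the strict inequality that starts the
    argument.\<close>
  proof (cases "t = 0")
    case True
    have "h \<noteq> 0" using h by auto
    then obtain \<theta> :: "'a \<Rightarrow> 'h" where \<theta>: "\<theta> \<in> L2 \<nu>" "\<not> (AE x in \<nu>. \<theta> x = 0)"
      "bounded (Supp \<nu> \<theta>)" "diameter (Supp \<nu> \<theta>) \<le> 2"
      by (rule exists_small_support[OF \<nu>])
    show ?thesis
    proof (rule that[OF \<theta>(1,2,3)])
      show "(c - \<epsilon>) * operator_norm \<nu> T * L2_norm \<nu> \<theta> \<le> L2_norm \<nu> (T \<theta>)"
        using True by (simp add: t_def)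
    qed (use \<theta>(4) in simp)
  next
    case False
    then have "0 < t" using \<open>0 \<le> t\<close> by simp
    \<comment> \<open>Half of \<epsilon> is given up here, the other half when the shell is
      deleted.\<close>
    define s1 where "s1 = (1 - \<epsilon> / 2) * t"
    have s1: "0 \<le> s1" "s1 < operator_norm \<nu> T"
      using \<open>0 < t\<close> \<epsilon> c by (auto simp: s1_def t_def[symmetric])
    obtain \<phi>0 where \<phi>0: "\<phi>0 \<in> L2 \<nu>" "s1 * L2_norm \<nu> \<phi>0 < L2_norm \<nu> (T \<phi>0)"
      by (rule operator_norm_witness[OF bop s1])
    define \<delta> where "\<delta> = (L2_norm \<nu> (T \<phi>0) - s1 * L2_norm \<nu> \<phi>0) / 2"
    have "0 < \<delta>" using \<phi>0(2) by (simp add: \<delta>_def)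
    obtain F where F: "finite F"
      "\<And>Q. Q \<in> sets \<nu> \<Longrightarrow> unit_balls \<nu> F \<subseteq> Q \<Longrightarrow> L2_norm \<nu> (T (cutoff (space \<nu> - Q) \<phi>0)) \<le> \<delta>"
      by (rule operator_exhaustion[OF sets T \<phi>0(1) \<open>0 < \<delta>\<close>]) blast
    \<comment> \<open>Cutting to finitely many balls costs half the slack of \<open>\<phi>0\<close>.
      It ensures that, away from Y, only finitely many \<open>A i\<close> are involved.\<close>
    define Q where "Q = unit_balls \<nu> F"
    have Q: "Q \<in> sets \<nu>"
      unfolding Q_def using F by (intro space_Int_closed_sets[OF sets]) auto
    define \<phi> where "\<phi> = cutoff Q \<phi>0"
    have \<phi>: "\<phi> \<in> L2 \<nu>" unfolding \<phi>_def by (rule L2_cutoff[OF \<phi>0(1) Q])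
    have "L2_norm \<nu> (T \<phi>0) \<le> L2_norm \<nu> (T \<phi>) + L2_norm \<nu> (T (cutoff (space \<nu> - Q) \<phi>0))"
      using Q \<phi>0(1) by (intro L2_norm_operator_triangle(1)[OF bop \<phi>] L2_cutoff sets.Diff sets.top) (auto simp: \<phi>_def indicator_def)
    moreover have "L2_norm \<nu> (T (cutoff (space \<nu> - Q) \<phi>0)) \<le> \<delta>"
      by (rule F(2)[OF Q]) (simp add: Q_def)
    moreover have "s1 * L2_norm \<nu> \<phi> \<le> s1 * L2_norm \<nu> \<phi>0"
      unfolding \<phi>_def by (intro mult_left_mono L2_norm_cutoff_le \<phi>0 Q s1)
    ultimately have \<phi>_big: "s1 * L2_norm \<nu> \<phi> < L2_norm \<nu> (T \<phi>)"
      using \<open>0 < \<delta>\<close> by (simp add: \<delta>_def field_simps)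

    define L where "L = 2 * real k + 3"
    have "0 < L" by (simp add: L_def)
    \<comment> \<open>\<open>infdist\<close> to the empty set is 0, whereas here everything has to be far from an empty \<open>Y\<close>.\<close>
    define g where "g x = (if Y = {} then real N * L + L else infdist x Y)" for x
    have g_meas [measurable]: "g \<in> borel_measurable \<nu>"
      unfolding g_def using infdist_meas[of Y] by (cases "Y = {}") simp_all
    have g_dist: "g x \<le> g y + dist x y" for x y
      using infdist_triangle[of x Y y] by (simp add: g_def)
    have "0 < N"
    proof -
      have "0 \<le> 4 / \<epsilon>\<^sup>2" by simp
      then show ?thesis using N by (cases N) auto
    qed
    \<comment> \<open>Shells of width L around Y, so that deleting one leaves two parts at distance
      at least L.\<close>
    define S where "S j = {x \<in> space \<nu>. real j * L \<le> g x \<and> g x < (real j + 1) * L}" for j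
    have S_sets: "S j \<in> sets \<nu>" for j unfolding S_def by measurable
    have S_disj: "disjoint_family_on S {..<N}"
    proof (unfold disjoint_family_on_def, intro ballI impI equals0I)
      fix i j x assume "i \<noteq> j" "x \<in> S i \<inter> S j"
      then have x: "real i * L \<le> g x" "g x < (real i + 1) * L" "real j * L \<le> g x" "g x < (real j + 1) * L"
        by (auto simp: S_def)
      have "real i * L < (real j + 1) * L" "real j * L < (real i + 1) * L"
        using x by linarith+
      then have "real i < real j + 1" "real j < real i + 1"
        using \<open>0 < L\<close> by (auto simp: mult_less_cancel_right)
      then show False using \<open>i \<noteq> j\<close> by linarith
    qed
    obtain j where j: "j < N" "(L2_norm \<nu> (cutoff (S j) \<phi>))\<^sup>2 \<le> (L2_norm \<nu> \<phi>)\<^sup>2 / real N"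
      by (rule slice_small[OF \<phi> \<open>0 < N\<close> _ S_disj]) (use S_sets in auto)
    \<comment> \<open>The choice of N: the mass 1/N is a square, so the norm of the lightest shell
      is at most \<epsilon>/2 times that of \<phi>.\<close>
    have "1 / real N \<le> (\<epsilon> / 2)\<^sup>2"
      using N \<open>0 < N\<close> \<epsilon>(1) by (simp add: field_simps power2_eq_square)
    then have "(L2_norm \<nu> (cutoff (S j) \<phi>))\<^sup>2 \<le> (\<epsilon> / 2 * L2_norm \<nu> \<phi>)\<^sup>2"
      using j(2) mult_right_mono[of "1 / real N" "(\<epsilon> / 2)\<^sup>2" "(L2_norm \<nu> \<phi>)\<^sup>2"]
      unfolding power_mult_distrib by simp
    then have slice: "L2_norm \<nu> (cutoff (S j) \<phi>) \<le> \<epsilon> / 2 * L2_norm \<nu> \<phi>"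
      by (rule power2_le_imp_le) (use \<epsilon>(1) in simp)
    define A1 where "A1 = {x \<in> space \<nu>. g x < real j * L}"
    define A2 where "A2 = {x \<in> space \<nu>. (real j + 1) * L \<le> g x}"
    have A12: "A1 \<in> sets \<nu>" "A2 \<in> sets \<nu>" unfolding A1_def A2_def by measurable
    define \<phi>' where "\<phi>' = cutoff (space \<nu> - S j) \<phi>"
    have \<phi>': "\<phi>' \<in> L2 \<nu>" unfolding \<phi>'_def using \<phi> S_sets by auto
    have "L2_norm \<nu> (T \<phi>) \<le> L2_norm \<nu> (T \<phi>') + L2_norm \<nu> (T (cutoff (S j) \<phi>))"
      using \<phi> S_sets by (intro L2_norm_operator_triangle(1)[OF bop \<phi>'] L2_cutoff) (auto simp: \<phi>'_def indicator_def)
    moreover have "L2_norm \<nu> (T (cutoff (S j) \<phi>)) \<le> t * (\<epsilon> / 2 * L2_norm \<nu> \<phi>)"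
      by (rule order_trans[OF t_le mult_left_mono[OF slice]]) (use \<phi> S_sets \<open>0 \<le> t\<close> in auto)
    moreover have "s1 * L2_norm \<nu> \<phi> = s * L2_norm \<nu> \<phi> + t * (\<epsilon> / 2 * L2_norm \<nu> \<phi>)"
      by (simp add: s1_def s_def algebra_simps)
    moreover have "s * L2_norm \<nu> \<phi>' \<le> s * L2_norm \<nu> \<phi>"
      unfolding \<phi>'_def using S_sets by (intro mult_left_mono L2_norm_cutoff_le \<phi> \<open>0 \<le> s\<close>) auto
    ultimately have big': "s * L2_norm \<nu> \<phi>' < L2_norm \<nu> (T \<phi>')"
      using \<phi>_big by linarith
    have "s * L2_norm \<nu> (cutoff A1 \<phi>') < L2_norm \<nu> (T (cutoff A1 \<phi>')) \<or>
        s * L2_norm \<nu> (cutoff A2 \<phi>') < L2_norm \<nu> (T (cutoff A2 \<phi>'))"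
    proof (rule ccontr)
      assume "\<not> ?thesis"
      then have le: "L2_norm \<nu> (T (cutoff A1 \<phi>')) \<le> s * L2_norm \<nu> (cutoff A1 \<phi>')"
        "L2_norm \<nu> (T (cutoff A2 \<phi>')) \<le> s * L2_norm \<nu> (cutoff A2 \<phi>')"
        by auto
      have "L2_norm \<nu> (T \<phi>') \<le> s * L2_norm \<nu> \<phi>'"
      proof (rule propagation_union_le[OF T \<phi>' _ A12 _ \<open>0 \<le> s\<close> _ infdist_meas le])
        show "\<phi>' x = 0" if "x \<in> space \<nu>" "x \<notin> A1 \<union> A2" for x
          using that by (auto simp: \<phi>'_def A1_def A2_def S_def indicator_def)
        show "2 * real k + 3 \<le> dist a b" if "a \<in> A1" "b \<in> A2" for a b
          using that g_dist[of b a] by (simp add: A1_def A2_def L_def dist_commute algebra_simps)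
      qed simp
      then show False using big' by simp
    qed
    then show ?thesis
    proof
      assume big1: "s * L2_norm \<nu> (cutoff A1 \<phi>') < L2_norm \<nu> (T (cutoff A1 \<phi>'))"
      have jN: "real j * L \<le> real N * L"
        using j(1) \<open>0 < L\<close> by simp
      \<comment> \<open>For empty Y the constant value of g lies beyond all N shells, so the inner
        part would be empty.\<close>
      have "Y \<noteq> {}"
      proof
        assume "Y = {}"
        have "\<not> real N * L + L < real j * L" using jN \<open>0 < L\<close> by linarith
        with \<open>Y = {}\<close> have "A1 = {}" unfolding A1_def g_def by simp
        then have "L2_norm \<nu> (cutoff A1 \<phi>') = 0" by (simp add: L2_norm_def)
        then show False
          using big1 t_le[OF L2_cutoff[OF \<phi>' A12(1)]] by simp
      qed
      have off: "cutoff A1 \<phi>' x = 0" if "x \<in> space \<nu>" "real (N * (2 * k + 3)) < infdist x Y" for x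
      proof -
        have "real (N * (2 * k + 3)) = real N * L" by (simp add: L_def)
        then have "\<not> infdist x Y < real j * L" using that(2) jN by linarith
        then have "x \<notin> A1" using \<open>Y \<noteq> {}\<close> unfolding A1_def g_def by simp
        then show ?thesis by simp
      qed
      obtain \<theta> where \<theta>: "\<theta> \<in> L2 \<nu>" "\<not> (AE x in \<nu>. \<theta> x = 0)" "bounded (Supp \<nu> \<theta>)"
        "diameter (Supp \<nu> \<theta>) \<le> real (fY (k + 2 * M + 1) + 2 * M)"
        "c * s * L2_norm \<nu> \<theta> \<le> L2_norm \<nu> (T \<theta>)"
        by (rule localization_near[OF sets T Y(2) c(1) \<open>Y \<noteq> {}\<close> h L2_cutoff[OF \<phi>' A12(1)] _ \<open>0 \<le> s\<close> big1 M(1)],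
            erule (1) off, blast)
      show ?thesis
        by (rule that[OF \<theta>(1,2,3) _ final[OF \<theta>(5)]]) (use \<theta>(4) in simp)
    next
      assume big2: "s * L2_norm \<nu> (cutoff A2 \<phi>') < L2_norm \<nu> (T (cutoff A2 \<phi>'))"
      define J where "J = (\<Union>y\<in>F. {i \<in> I. A i \<inter> A2 \<inter> cball y 1 \<noteq> {}})"
      have A2Y: "x \<notin> Y" if "x \<in> A2" for x
      proof
        assume "x \<in> Y"
        then have "g x = 0" by (auto simp: g_def)
        moreover have "0 < (real j + 1) * L" using \<open>0 < L\<close> by (intro mult_pos_pos) auto
        ultimately show False using that by (simp add: A2_def)
      qed
      have far: "2 * real k + 3 \<le> dist a b"
        if "i \<in> I" "i' \<in> I" "i \<noteq> i'" "a \<in> A i \<inter> A2" "b \<in> A i' \<inter> A2" for i i' a b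
        by (rule r_disjoint_dist[OF disj that(1,2,3)]) (use that A2Y in auto)
      have "finite J"
        unfolding J_def
      proof (rule finite_UN_I[OF F(1)])
        fix y
        \<comment> \<open>Two points of a unit ball are at distance at most 2, but distinct
          \<open>A i\<close> are at least 2k+3 apart beyond the shell.\<close>
        have "i = i'" if ii: "i \<in> I" "A i \<inter> A2 \<inter> cball y 1 \<noteq> {}" "i' \<in> I" "A i' \<inter> A2 \<inter> cball y 1 \<noteq> {}" for i i'
        proof (rule ccontr)
          assume "i \<noteq> i'"
          obtain a b where ab: "a \<in> A i \<inter> A2" "dist y a \<le> 1" "b \<in> A i' \<inter> A2" "dist y b \<le> 1"
            using ii(2,4) by fastforce
          then show False
            using far[OF ii(1,3) \<open>i \<noteq> i'\<close> ab(1,3)] dist_triangle3[of a b y] by simp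
        qed
        then show "finite {i \<in> I. A i \<inter> A2 \<inter> cball y 1 \<noteq> {}}"
          by (intro finite_if_at_most_one) blast
      qed
      have JI: "J \<subseteq> I" by (auto simp: J_def)
      have B_sets: "A i \<inter> A2 \<in> sets \<nu>" if "i \<in> I" for i
        using A[OF that] A12(2) by (simp add: sets sets.Int)
      let ?\<phi>2 = "cutoff A2 \<phi>'"
      have "\<exists>i\<in>J. s * L2_norm \<nu> (cutoff (A i \<inter> A2) ?\<phi>2) < L2_norm \<nu> (T (cutoff (A i \<inter> A2) ?\<phi>2))"
      proof (rule ccontr)
        assume "\<not> ?thesis"
        then have le: "L2_norm \<nu> (T (cutoff (A i \<inter> A2) ?\<phi>2)) \<le> s * L2_norm \<nu> (cutoff (A i \<inter> A2) ?\<phi>2)"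
          if "i \<in> J" for i
          using that by (auto simp: not_less)
        have "L2_norm \<nu> (T ?\<phi>2) \<le> s * L2_norm \<nu> ?\<phi>2"
        proof (rule propagation_finite_union_le[OF T \<open>finite J\<close> L2_cutoff[OF \<phi>' A12(2)] _ _ _ \<open>0 \<le> s\<close> _ infdist_meas,
              where B = "\<lambda>i. A i \<inter> A2"])
          show "?\<phi>2 x = 0" if "x \<in> space \<nu>" "x \<notin> (\<Union>i\<in>J. A i \<inter> A2)" for x
          proof (rule ccontr)
            assume "?\<phi>2 x \<noteq> 0"
            then have "x \<in> A2" "x \<in> Q"
              by (auto simp: \<phi>'_def \<phi>_def indicator_def split: if_splits)
            moreover obtain i where "i \<in> I" "x \<in> A i" using \<open>x \<in> space \<nu>\<close> space X by auto
            ultimately have "i \<in> J" unfolding J_def Q_def by blast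
            then show False using that(2) \<open>x \<in> A i\<close> \<open>x \<in> A2\<close> by blast
          qed
          show "2 * real k + 3 \<le> dist a b"
            if "i \<in> J" "i' \<in> J" "i \<noteq> i'" "a \<in> A i \<inter> A2" "b \<in> A i' \<inter> A2" for i i' a b
            using far[OF _ _ that(3,4,5)] that(1,2) JI by blast
        qed (use le B_sets JI in auto)
        then show False using big2 by simp
      qed
      then obtain i where i: "i \<in> J"
        and bigi: "s * L2_norm \<nu> (cutoff (A i \<inter> A2) ?\<phi>2) < L2_norm \<nu> (T (cutoff (A i \<inter> A2) ?\<phi>2))"
        by blast
      have "i \<in> I" "A i \<noteq> {}" using i by (auto simp: J_def)
      \<comment> \<open>Radius 0: the piece lies inside \<open>A i\<close>, where
        \<open>infdist\<close> vanishes.\<close>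
      have off: "cutoff (A i \<inter> A2) ?\<phi>2 x = 0" if "x \<in> space \<nu>" "real 0 < infdist x (A i)" for x
        using that(2) by (auto simp: indicator_def)
      have M': "M' = 0 + k + 4" using M by simp
      obtain \<theta> where \<theta>: "\<theta> \<in> L2 \<nu>" "\<not> (AE x in \<nu>. \<theta> x = 0)" "bounded (Supp \<nu> \<theta>)"
        "diameter (Supp \<nu> \<theta>) \<le> real (fA (k + 2 * M' + 1) + 2 * M')"
        "c * s * L2_norm \<nu> \<theta> \<le> L2_norm \<nu> (T \<theta>)"
        by (rule localization_near[OF sets T fA[OF \<open>i \<in> I\<close>] c(1) \<open>A i \<noteq> {}\<close> h
              L2_cutoff[OF L2_cutoff[OF \<phi>' A12(2)] B_sets[OF \<open>i \<in> I\<close>]] _ \<open>0 \<le> s\<close> bigi M'],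
            erule (1) off, blast)
      show ?thesis
        by (rule that[OF \<theta>(1,2,3) _ final[OF \<theta>(5)]]) (use \<theta>(4) in simp)
    qed
  qed
qed

theorem proposition5p2:
  fixes X :: "'a::metric_space set"
    and I :: "'i set"
    and A :: "'i \<Rightarrow> 'a set"
    and c :: real
  assumes "infinite_dimensional TYPE('h::{complex_hilbert,second_countable_topology})"
    and "X = (\<Union>i\<in>I. A i)"
    and "\<And>i. i \<in> I \<Longrightarrow> A i \<in> sets (restrict_space borel X)"
    and "0 < c" and "c \<le> 1"
    and "uniform_operator_norm_localization TYPE('h) I A c"
    and "\<And>r::real. 0 < r \<Longrightarrow>
      \<exists>Y \<in> sets (restrict_space borel X).
        operator_norm_localization TYPE('h) Y c \<and> r_disjoint r I (\<lambda>i. A i - Y)"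
  shows "\<forall>\<epsilon>::real. 0 < \<epsilon> \<and> \<epsilon> < c \<longrightarrow> operator_norm_localization TYPE('h) X (c - \<epsilon>)"
proof (intro allI impI)
  fix \<epsilon> :: real assume "0 < \<epsilon> \<and> \<epsilon> < c"
  then have \<epsilon>: "0 < \<epsilon>" "\<epsilon> < c" by auto
  \<comment> \<open>Otherwise the empty family would span H.\<close>
  have "\<exists>x::'h. x \<noteq> 0"
  proof (rule ccontr)
    assume "\<not> ?thesis"
    then have "finite ({}::'h set) \<and> (\<forall>x::'h. \<exists>u. x = (\<Sum>b\<in>{}. u b *\<^sub>C b))" by simp
    then show False using assms(1) unfolding infinite_dimensional_def by blast
  qed
  then obtain x :: 'h where "x \<noteq> 0" by blast
  define h where "h = sgn x"
  have h: "norm h = 1" using \<open>x \<noteq> 0\<close> by (simp add: h_def norm_sgn)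
  obtain N :: nat where N: "4 / \<epsilon>\<^sup>2 < real N" using reals_Archimedean2 by blast
  obtain fA where fA: "\<And>i. i \<in> I \<Longrightarrow> onl_with TYPE('h) (A i) c fA"
    using assms(6) by (auto simp: uniform_operator_norm_localization_def)
  \<comment> \<open>The separation depends on k alone, so Y and its function are fixed before \<nu>
    and T.\<close>
  have "\<exists>Y fY. Y \<in> sets (restrict_space borel X) \<and> onl_with TYPE('h) Y c fY \<and>
      r_disjoint (2 * real k + 3) I (\<lambda>i. A i - Y)" for k :: nat
    using assms(7)[of "2 * real k + 3"] by (auto simp: operator_norm_localization_def)
  then obtain Y fY where Y: "\<And>k. Y k \<in> sets (restrict_space borel X)"
    "\<And>k. onl_with TYPE('h) (Y k) c (fY k)" "\<And>k::nat. r_disjoint (2 * real k + 3) I (\<lambda>i. A i - Y k)"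
    by metis
  define M where "M k = N * (2 * k + 3) + k + 4" for k
  define d where "d k = fY k (k + 2 * M k + 1) + 2 * M k + (fA (k + 2 * (k + 4) + 1) + 2 * (k + 4)) + 2" for k
  \<comment> \<open>Y changes with k, so d need not be monotone; its partial sums are, and they
    dominate it.\<close>
  define f where "f k = (\<Sum>i\<le>k. d i)" for k
  have "mono f"
    unfolding f_def by (intro monoI sum_mono2) auto
  moreover have "onl_with TYPE('h) X (c - \<epsilon>) f"
    unfolding onl_with_def
  proof (intro allI impI ballI)
    fix \<nu> :: "'a measure" and k and T :: "('a \<Rightarrow> 'h) \<Rightarrow> ('a \<Rightarrow> 'h)"
    assume \<nu>: "positive_locally_finite_borel X \<nu>" and T: "T \<in> propagation_at_most (real k) \<nu>"
    obtain \<theta> where \<theta>: "\<theta> \<in> L2 \<nu>" "\<not> (AE x in \<nu>. \<theta> x = 0)" "bounded (Supp \<nu> \<theta>)"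
      "diameter (Supp \<nu> \<theta>) \<le> real (d k)"
      "(c - \<epsilon>) * operator_norm \<nu> T * L2_norm \<nu> \<theta> \<le> L2_norm \<nu> (T \<theta>)"
      unfolding d_def
      by (rule union_localization_step[OF assms(2) _ _ Y(1,2,3) assms(4,5) \<epsilon> N h M_def refl \<nu> T],
          erule assms(3), erule fA, blast)
    have "d k \<le> f k"
      unfolding f_def by (rule member_le_sum) auto
    then have "diameter (Supp \<nu> \<theta>) \<le> real (f k)" using \<theta>(4) by linarith
    with \<theta> show "\<exists>\<phi>. \<phi> \<in> L2 \<nu> \<and> \<not> (AE x in \<nu>. \<phi> x = 0) \<and> bounded (Supp \<nu> \<phi>) \<and>
        diameter (Supp \<nu> \<phi>) \<le> real (f k) \<and> (c - \<epsilon>) * operator_norm \<nu> T * L2_norm \<nu> \<phi> \<le> L2_norm \<nu> (T \<phi>)"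
      by blast
  qed
  ultimately show "operator_norm_localization TYPE('h) X (c - \<epsilon>)"
    unfolding operator_norm_localization_def by blast
qed

end
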